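(* Let $X$ be a real Hilbert space, $I=\{1,\dots,m\}$, $A$ a closed convex subset of $X$ and $(B_i)_{i\in I}$ closed convex subsets with $C=A\cap\bigcap_{i\in I}B_i\ne\varnothing$. For $i\in I$ set $T_i=P_{B_i}R_A+\mathrm{Id}-P_A$, $Z_i=\operatorname{Fix}T_i$, $Z=\bigcap_{i\in I}Z_i$, and $T=T_m\cdots T_2T_1$. Let $x_0\in X$ and $x_{n+1}=Tx_n$. Suppose one of the following holds: (i) $X$ is finite-dimensional and $\operatorname{ri}(A)\cap\bigcap_{i\in I}\operatorname{ri}(B_i)\ne\varnothing$; (ii) $A$ and each $B_i$ are closed linear subspaces with $A+B_i$ closed for each $i$, and the family $(Z_i)_{i\in I}$ is boundedly linearly regular. Then $(x_n)$ converges linearly to a point $\bar x\in Z$, and $P_A\bar x\in C$.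
   Context: $P_S$ is the metric projection onto a closed convex set $S$ and $R_S=2P_S-\mathrm{Id}$. A finite family $(C_i)_{i\in I}$ of closed convex sets with $C'=\bigcap_iC_i\ne\varnothing$ is boundedly linearly regular if for every $\rho>0$ there is $\mu>0$ with $d_{C'}(x)\le\mu\max_{i}d_{C_i}(x)$ for all $\|x\|\le\rho$. Linear convergence to $\bar x$ means $\|x_n-\bar x\|\le cq^n$ for some $c\ge0$, $q\in[0,1[$. *)

theory Defs
  imports "HOL-Analysis.Analysis"
begin

text \<open>Metric projection onto a set S (the unique nearest point when S is
nonempty, closed and convex in a real Hilbert space).\<close>
definition proj :: "'a::real_inner set \<Rightarrow> 'a \<Rightarrow> 'a" where
  "proj S x = (SOME p. p \<in> S \<and> (\<forall>y\<in>S. dist x p \<le> dist x y))"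

definition reflector :: "'a::real_inner set \<Rightarrow> 'a \<Rightarrow> 'a" where
  "reflector S x = 2 *\<^sub>R proj S x - x"

definition Fix :: "('a \<Rightarrow> 'a) \<Rightarrow> 'a set" where
  "Fix f = {x. f x = x}"

fun comp_upto :: "(nat \<Rightarrow> 'a \<Rightarrow> 'a) \<Rightarrow> nat \<Rightarrow> 'a \<Rightarrow> 'a" where
  "comp_upto T 0 = id"
| "comp_upto T (Suc k) = T (Suc k) \<circ> comp_upto T k"

definition bdd_lin_regular :: "'i set \<Rightarrow> ('i \<Rightarrow> 'a::real_normed_vector set) \<Rightarrow> bool" where
  "bdd_lin_regular I C \<longleftrightarrow> (\<Inter>i\<in>I. C i) \<noteq> {} \<and>
     (\<forall>\<rho>>0. \<exists>\<mu>>0. \<forall>x. norm x \<le> \<rho> \<longrightarrow>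
        infdist x (\<Inter>i\<in>I. C i) \<le> \<mu> * Max ((\<lambda>i. infdist x (C i)) ` I))"

definition lin_conv :: "(nat \<Rightarrow> 'a::real_normed_vector) \<Rightarrow> 'a \<Rightarrow> bool" where
  "lin_conv x xb \<longleftrightarrow> (\<exists>c q. c \<ge> 0 \<and> 0 \<le> q \<and> q < 1 \<and> (\<forall>n. norm (x n - xb) \<le> c * q ^ n))"

end

theory Submission
  imports Defs
begin

text \<open>Each Douglas--Rachford operator T is firmly quasi-nonexpansive, so along one sweep of the
  composition the squared distance to a common fixed point drops by at least the sum of the squared
  displacements. If A - B lies in a subspace S and contains a ball of S, then the fixed point set of T
  is (A \<inter> B) + (the orthogonal complement of S), and on bounded sets the distance to it is at
  most a multiple of the displacement. Together with bounded linear regularity of the fixed point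
  sets, each sweep contracts the distance to Z by a factor q < 1, and Fejer monotonicity turns this
  into linear convergence. For subspaces with closed sum, the ball comes from the open mapping theorem
  (proved by Baire category and successive approximation); in finite dimension, both the ball and the
  bounded linear regularity come from a common relative interior point.\<close>

section \<open>Projections\<close>

text \<open>One statement covers both alternatives, so finite dimension is a hypothesis on the type
  and the space is only known to be complete. No compactness is used: limits come from geometric
  series and Cauchy estimates. What both alternatives supply is collected in
  \<open>relatively_absorbing\<close>. Besides a ball of S inside A - B it records a uniform bound
  on the points of A that represent this ball. That bound turns the algebraic description of the
  fixed point set into an error estimate, and it is the reason for the quantitative form
  \<open>open_sum\<close> of openness of addition. The subspace S changes with the index i, so the
  fixed point sets extend in different orthogonal directions and their regularity is a separate
  question. In finite dimension it holds because a point c in the relative interiors of A and all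
  B_i also has, inside each fixed point set, a ball of the direction space of that set, with one
  radius for all i.\<close>

lemma convergent_of_geometric_steps:
  fixes y :: "nat \<Rightarrow> 'a::complete_space"
  assumes q: "0 \<le> q" "q < 1" and step: "\<And>n. dist (y (Suc n)) (y n) \<le> K * q ^ n"
  shows "\<exists>l. y \<longlonglongrightarrow> l \<and> (\<forall>n. dist (y n) l \<le> K / (1 - q) * q ^ n)"
proof -
  have K: "0 \<le> K" using order_trans[OF zero_le_dist step[of 0]] by simp
  have D: "dist (y (n + k)) (y n) \<le> K / (1 - q) * q ^ n" for n k
  proof -
    \<comment> \<open>Keeping the exact partial geometric sum lets the induction close; the bound
      without the subtracted term would not carry over to \<open>Suc k\<close>.\<close>
    have "dist (y (n + k)) (y n) \<le> K / (1 - q) * (q ^ n - q ^ (n + k))"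
    proof (induction k)
      case (Suc k)
      have "dist (y (n + Suc k)) (y n) \<le> dist (y (Suc (n + k))) (y (n + k)) + dist (y (n + k)) (y n)"
        by (simp add: dist_triangle)
      also have "\<dots> \<le> K * q ^ (n + k) + K / (1 - q) * (q ^ n - q ^ (n + k))"
        using Suc step[of "n + k"] by simp
      also have "\<dots> = K / (1 - q) * (q ^ n - q ^ (n + Suc k))"
        using q by (simp add: field_simps)
      finally show ?case .
    qed simp
    also have "\<dots> \<le> K / (1 - q) * q ^ n"
      using q K by (intro mult_left_mono) auto
    finally show ?thesis .
  qed
  have lim0: "(\<lambda>n. K / (1 - q) * q ^ n) \<longlonglongrightarrow> 0"
    using q by (intro tendsto_mult_right_zero LIMSEQ_power_zero) auto
  have "Cauchy y"
    unfolding Cauchy_altdef2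
  proof (intro allI impI)
    fix e :: real assume "e > 0"
    then obtain N where "\<forall>n\<ge>N. K / (1 - q) * q ^ n < e"
      using order_tendstoD(2)[OF lim0] unfolding eventually_sequentially by blast
    then show "\<exists>N. \<forall>n\<ge>N. dist (y n) (y N) < e"
      by (metis D le_add_diff_inverse order_refl order_le_less_trans)
  qed
  then obtain l where l: "y \<longlonglongrightarrow> l" by (auto simp: Cauchy_convergent_iff convergent_def)
  have "dist (y n) l \<le> K / (1 - q) * q ^ n" for n
  proof -
    have "(\<lambda>k. dist (y (k + n)) (y n)) \<longlonglongrightarrow> dist l (y n)"
      by (intro tendsto_intros LIMSEQ_ignore_initial_segment l)
    then have "dist l (y n) \<le> K / (1 - q) * q ^ n"
      by (rule LIMSEQ_le_const2) (use D[of n] in \<open>auto simp: add.commute\<close>)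
    then show ?thesis by (simp add: dist_commute)
  qed
  then show ?thesis using l by blast
qed

text \<open>A minimizing sequence is Cauchy by the parallelogram law: the midpoint of two of its
  points lies in S, hence at distance at least d from x, which forces nearly minimal points to be
  close to each other.\<close>

lemma nearest_point_exists:
  fixes S :: "'a::{real_inner, complete_space} set"
  assumes S: "closed S" "convex S" "S \<noteq> {}"
  shows "\<exists>p\<in>S. \<forall>y\<in>S. dist x p \<le> dist x y"
proof -
  define d where "d = infdist x S"
  have "\<exists>p\<in>S. dist x p < d + 1 / real (Suc n)" for n
    using cINF_less_iff[of S "dist x" "infdist x S + 1 / real (Suc n)"] S(3)
    unfolding d_def by (simp add: infdist_notempty del: of_nat_Suc)
  then obtain y where y: "\<And>n. y n \<in> S" "\<And>n. dist x (y n) < d + 1 / real (Suc n)" by metis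
  have d0: "d \<ge> 0" unfolding d_def by (simp add: infdist_nonneg)
  have par: "(dist (y i) (y j))\<^sup>2 \<le> 4 * (2 * d + 1) / real (Suc n)" if "i \<ge> n" "j \<ge> n" for i j n
  proof -
    have m: "(1/2) *\<^sub>R y i + (1/2) *\<^sub>R y j \<in> S"
      by (rule convexD[OF S(2)]) (use y(1) in auto)
    then have "d \<le> dist x ((1/2) *\<^sub>R y i + (1/2) *\<^sub>R y j)" unfolding d_def by (rule infdist_le)
    moreover have "x - ((1/2) *\<^sub>R y i + (1/2) *\<^sub>R y j) = (1/2) *\<^sub>R ((x - y i) + (x - y j))"
      by (simp add: algebra_simps flip: scaleR_add_left)
    ultimately have "2 * d \<le> norm ((x - y i) + (x - y j))" by (simp add: dist_norm)
    then have a: "4 * d\<^sup>2 \<le> (norm ((x - y i) + (x - y j)))\<^sup>2"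
      using d0 power_mono[of "2 * d" _ 2] by (simp add: power_mult_distrib)
    have "real (Suc n) \<le> real (Suc i)" "real (Suc n) \<le> real (Suc j)" using that by auto
    then have "1 / real (Suc i) \<le> 1 / real (Suc n)" "1 / real (Suc j) \<le> 1 / real (Suc n)"
      by (auto intro!: divide_left_mono simp del: of_nat_Suc)
    then have "norm (x - y i) \<le> d + 1 / real (Suc n)" "norm (x - y j) \<le> d + 1 / real (Suc n)"
      using y(2)[of i] y(2)[of j] by (simp_all add: dist_norm)
    then have b: "(norm (x - y i))\<^sup>2 \<le> (d + 1 / real (Suc n))\<^sup>2" "(norm (x - y j))\<^sup>2 \<le> (d + 1 / real (Suc n))\<^sup>2"
      by (auto intro: power_mono)
    have "(dist (y i) (y j))\<^sup>2 = 2 * (norm (x - y i))\<^sup>2 + 2 * (norm (x - y j))\<^sup>2 - (norm ((x - y i) + (x - y j)))\<^sup>2"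
      unfolding dist_norm power2_norm_eq_inner by (simp add: inner_simps inner_commute algebra_simps)
    also have "\<dots> \<le> 4 * (d + 1 / real (Suc n))\<^sup>2 - 4 * d\<^sup>2" using a b by linarith
    also have "\<dots> = 4 * (2 * d + 1 / real (Suc n)) * (1 / real (Suc n))"
      by (simp add: power2_eq_square algebra_simps del: of_nat_Suc)
    also have "\<dots> \<le> 4 * (2 * d + 1) * (1 / real (Suc n))"
      by (intro mult_right_mono mult_left_mono) auto
    finally show ?thesis by simp
  qed
  have lim: "(\<lambda>n. sqrt (4 * (2 * d + 1) / real (Suc n))) \<longlonglongrightarrow> sqrt 0"
    by (intro tendsto_real_sqrt LIMSEQ_Suc lim_const_over_n)
  have "Cauchy y"
    unfolding Cauchy_altdef2
  proof (intro allI impI)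
    fix e :: real assume "e > 0"
    then obtain N where N: "\<forall>n\<ge>N. sqrt (4 * (2 * d + 1) / real (Suc n)) < e"
      using order_tendstoD(2)[OF lim[unfolded real_sqrt_zero]] unfolding eventually_sequentially by blast
    have "dist (y n) (y N) < e" if "n \<ge> N" for n
      using order_le_less_trans[OF real_le_rsqrt[OF par[OF that order_refl]] N[rule_format, OF order_refl]] .
    then show "\<exists>N. \<forall>n\<ge>N. dist (y n) (y N) < e" by blast
  qed
  then obtain p where p: "y \<longlonglongrightarrow> p" by (auto simp: Cauchy_convergent_iff convergent_def)
  have "p \<in> S" using closed_sequentially[OF S(1)] y(1) p by blast
  moreover have "dist x p \<le> dist x z" if "z \<in> S" for z
  proof -
    have "(\<lambda>n. dist x (y n)) \<longlonglongrightarrow> dist x p" by (intro tendsto_intros p)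
    moreover have "(\<lambda>n. d + 1 / real (Suc n)) \<longlonglongrightarrow> d + 0"
      by (intro tendsto_intros LIMSEQ_Suc lim_const_over_n)
    ultimately have "dist x p \<le> d + 0"
      by (rule LIMSEQ_le) (use y(2) in \<open>auto intro: less_imp_le\<close>)
    then show ?thesis using infdist_le[OF that, of x] unfolding d_def by simp
  qed
  ultimately show ?thesis by blast
qed

lemma
  fixes S :: "'a::{real_inner, complete_space} set"
  assumes S: "closed S" "convex S" "S \<noteq> {}"
  shows proj_in: "proj S x \<in> S"
    and proj_nearest: "y \<in> S \<Longrightarrow> dist x (proj S x) \<le> dist x y"
    and proj_obtuse: "y \<in> S \<Longrightarrow> (x - proj S x) \<bullet> (y - proj S x) \<le> 0"
proof -
  have P: "proj S x \<in> S \<and> (\<forall>y\<in>S. dist x (proj S x) \<le> dist x y)"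
    unfolding proj_def by (rule someI_ex) (use nearest_point_exists[OF S, of x] in blast)
  then show "proj S x \<in> S" "y \<in> S \<Longrightarrow> dist x (proj S x) \<le> dist x y" by simp_all
  show "(x - proj S x) \<bullet> (y - proj S x) \<le> 0" if "y \<in> S"
    using any_closest_point_dot[OF S(2,1) _ that, of "proj S x" x] P by blast
qed

text \<open>The obtuse-angle inequalities at c and at \<open>proj S x\<close>, each tested with the
  other point, add up to a nonpositive squared distance. The lemma serves to recognise a projection
  from its variational inequality.\<close>

lemma proj_unique:
  fixes S :: "'a::{real_inner, complete_space} set"
  assumes S: "closed S" "convex S" and c: "c \<in> S" and ob: "\<And>y. y \<in> S \<Longrightarrow> (x - c) \<bullet> (y - c) \<le> 0"
  shows "proj S x = c"
proof -
  have ne: "S \<noteq> {}" using c by auto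
  have "(x - c) \<bullet> (proj S x - c) \<le> 0" by (rule ob) (rule proj_in[OF S ne])
  moreover have "(x - proj S x) \<bullet> (c - proj S x) \<le> 0" by (rule proj_obtuse[OF S ne c])
  ultimately have "(proj S x - c) \<bullet> (proj S x - c) \<le> 0"
    by (simp add: inner_simps inner_commute algebra_simps)
  then show ?thesis by (metis inner_ge_zero inner_eq_zero_iff antisym eq_iff_diff_eq_0)
qed

text \<open>Only the orthogonal component is demanded, so the property can come from a metric
  projection when S is closed, or from an orthogonal basis in finite dimension without a discussion
  of closedness.\<close>

definition orth_decomposable :: "'a::real_inner set \<Rightarrow> bool" where
  "orth_decomposable S \<longleftrightarrow> (\<forall>x. \<exists>s\<in>S. \<forall>t\<in>S. (x - s) \<bullet> t = 0)"

lemma orth_decomposable_closed_subspace: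
  fixes S :: "'a::{real_inner, complete_space} set"
  assumes "closed S" "subspace S"
  shows "orth_decomposable S"
  unfolding orth_decomposable_def
proof
  fix x
  have S: "closed S" "convex S" "S \<noteq> {}"
    using assms subspace_imp_convex subspace_0 by blast+
  have p: "proj S x \<in> S" by (rule proj_in[OF S])
  have "(x - proj S x) \<bullet> t = 0" if "t \<in> S" for t
  proof -
    have "proj S x + t \<in> S" "proj S x - t \<in> S"
      using assms(2) p that by (simp_all add: subspace_add subspace_diff)
    from this[THEN proj_obtuse[OF S, where x = x]] show ?thesis by (auto simp: inner_simps)
  qed
  then show "\<exists>s\<in>S. \<forall>t\<in>S. (x - s) \<bullet> t = 0" using p by blast
qed

text \<open>A predicate on the type instead of a type class, because it has to appear as one branch
  of a disjunction.\<close>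

definition fin_dim :: "'a::real_vector itself \<Rightarrow> bool" where
  "fin_dim _ \<longleftrightarrow> (\<exists>S. finite S \<and> span S = (UNIV :: 'a set))"

lemma fin_dim_orthogonal_basis:
  fixes S :: "'a::real_inner set"
  assumes fd: "fin_dim TYPE('a)" and S: "subspace S"
  obtains B where "finite B" "span B = S" "0 \<notin> B" "pairwise orthogonal B"
proof -
  obtain F :: "'a set" where F: "finite F" "span F = UNIV" using fd unfolding fin_dim_def by blast
  obtain B0 where B0: "B0 \<subseteq> S" "independent B0" "S \<subseteq> span B0" by (rule basis_exists)
  have "finite B0" using independent_span_bound[OF F(1) B0(2)] F by auto
  from basis_orthogonal[OF this] obtain B where B: "finite B" "span B = span B0" "pairwise orthogonal B"
    by blast
  have "span B = S" using B B0 S by (metis span_minimal subset_antisym)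
  then have "span (B - {0}) = S" by (simp add: span_delete_0)
  then show ?thesis using that[of "B - {0}"] B by (auto simp: pairwise_def)
qed

lemma orthogonal_expansion:
  fixes B :: "'a::real_inner set"
  assumes B: "finite B" "pairwise orthogonal B" and t: "t \<in> span B"
  shows "(x - (\<Sum>b\<in>B. ((b \<bullet> x) / (b \<bullet> b)) *\<^sub>R b)) \<bullet> t = 0"
proof -
  let ?r = "x - (\<Sum>b\<in>B. ((b \<bullet> x) / (b \<bullet> b)) *\<^sub>R b)"
  have "?r \<bullet> b = 0" if b: "b \<in> B" for b
  proof -
    \<comment> \<open>A zero vector in B does no harm: for b = 0 both the quotient times
      \<open>b \<bullet> b\<close> and \<open>b \<bullet> x\<close> vanish.\<close>
    have "(\<Sum>b'\<in>B. ((b' \<bullet> x) / (b' \<bullet> b')) *\<^sub>R b') \<bullet> b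
        = (\<Sum>b'\<in>B. if b' = b then (b \<bullet> x) / (b \<bullet> b) * (b \<bullet> b) else 0)"
      unfolding inner_sum_left
      by (intro sum.cong refl) (use B(2) b in \<open>auto simp: pairwise_def orthogonal_def\<close>)
    also have "\<dots> = b \<bullet> x" using B(1) b by simp
    finally show ?thesis by (simp add: inner_diff_left inner_commute[of x b])
  qed
  then have "span B \<subseteq> {t. ?r \<bullet> t = 0}"
    by (intro span_minimal) (auto simp: subspace_def inner_simps)
  then show ?thesis using t by blast
qed

lemma orth_decomposable_fin_dim:
  fixes S :: "'a::real_inner set"
  assumes "fin_dim TYPE('a)" "subspace S"
  shows "orth_decomposable S"
proof -
  obtain B where B: "finite B" "span B = S" "pairwise orthogonal B"
    using fin_dim_orthogonal_basis[OF assms] by metis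
  show ?thesis
    unfolding orth_decomposable_def
  proof
    fix x
    let ?s = "\<Sum>b\<in>B. ((b \<bullet> x) / (b \<bullet> b)) *\<^sub>R b"
    have "?s \<in> span B" by (intro span_sum span_scale span_base)
    moreover have "\<forall>t\<in>span B. (x - ?s) \<bullet> t = 0" using orthogonal_expansion[OF B(1,3)] by blast
    ultimately show "\<exists>s\<in>S. \<forall>t\<in>S. (x - s) \<bullet> t = 0" unfolding B(2) by blast
  qed
qed

section \<open>Sums of subspaces\<close>

text \<open>Quantitative openness of addition from L x M onto L + M. It is enough to control the
  first summand; the triangle inequality then bounds the second by k + 1 times the norm of the
  sum.\<close>

definition open_sum :: "'a::real_normed_vector set \<Rightarrow> 'a set \<Rightarrow> bool" where
  "open_sum L M \<longleftrightarrow> (\<exists>k\<ge>0. \<forall>l\<in>L. \<forall>m\<in>M. \<exists>l'\<in>L. \<exists>m'\<in>M. l + m = l' + m' \<and> norm l' \<le> k * norm (l + m))"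

text \<open>Only the finitely many vectors of an orthogonal basis of L + M are split, and the
  splitting is extended linearly. Since the coefficient of b is at most
  \<open>norm s / norm b\<close>, the constant is the sum of the ratios
  \<open>norm (f b) / norm b\<close>.\<close>

lemma open_sum_fin_dim:
  fixes L :: "'a::real_inner set"
  assumes fd: "fin_dim TYPE('a)" and L: "subspace L" and M: "subspace M"
  shows "open_sum L M"
proof -
  have S: "subspace {l + m | l m. l \<in> L \<and> m \<in> M}" by (rule subspace_sums[OF L M])
  obtain B where B: "finite B" "span B = {l + m | l m. l \<in> L \<and> m \<in> M}" "0 \<notin> B" "pairwise orthogonal B"
    by (rule fin_dim_orthogonal_basis[OF fd S])
  have "\<exists>l m. l \<in> L \<and> m \<in> M \<and> b = l + m" if "b \<in> B" for b
    using span_base[OF that] unfolding B(2) by blast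
  then obtain f g where fg: "\<And>b. b \<in> B \<Longrightarrow> f b \<in> L \<and> g b \<in> M \<and> b = f b + g b" by metis
  define k where "k = (\<Sum>b\<in>B. norm (f b) / norm b)"
  have k: "k \<ge> 0" unfolding k_def by (intro sum_nonneg) auto
  have "\<exists>l'\<in>L. \<exists>m'\<in>M. l + m = l' + m' \<and> norm l' \<le> k * norm (l + m)" if lm: "l \<in> L" "m \<in> M" for l m
  proof -
    define s where "s = l + m"
    define c where "c b = (b \<bullet> s) / (b \<bullet> b)" for b
    have sB: "s \<in> span B" unfolding B(2) s_def using lm by blast
    have "s - (\<Sum>b\<in>B. c b *\<^sub>R b) \<in> span B"
      by (intro span_diff sB span_sum span_scale span_base)
    then have "(s - (\<Sum>b\<in>B. c b *\<^sub>R b)) \<bullet> (s - (\<Sum>b\<in>B. c b *\<^sub>R b)) = 0"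
      using orthogonal_expansion[OF B(1,4), of _ s] unfolding c_def by blast
    then have "s = (\<Sum>b\<in>B. c b *\<^sub>R b)" by simp
    also have "\<dots> = (\<Sum>b\<in>B. c b *\<^sub>R f b + c b *\<^sub>R g b)"
      by (intro sum.cong refl) (metis fg scaleR_add_right)
    finally have s: "s = (\<Sum>b\<in>B. c b *\<^sub>R f b) + (\<Sum>b\<in>B. c b *\<^sub>R g b)" by (simp add: sum.distrib)
    have "norm (\<Sum>b\<in>B. c b *\<^sub>R f b) \<le> (\<Sum>b\<in>B. norm (f b) / norm b * norm s)"
    proof (rule sum_norm_le)
      fix b assume b: "b \<in> B"
      then have nb: "norm b > 0" using B(3) by auto
      have "\<bar>c b\<bar> \<le> norm b * norm s / (norm b)\<^sup>2"
        unfolding c_def abs_divide power2_norm_eq_inner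
        using Cauchy_Schwarz_ineq2[of b s] by (intro divide_mono) (use nb in auto)
      also have "\<dots> = norm s / norm b" using nb by (simp add: power2_eq_square)
      finally have "norm (c b *\<^sub>R f b) \<le> norm s / norm b * norm (f b)"
        unfolding norm_scaleR by (rule mult_right_mono) simp
      then show "norm (c b *\<^sub>R f b) \<le> norm (f b) / norm b * norm s" by (simp add: mult.commute)
    qed
    then have "norm (\<Sum>b\<in>B. c b *\<^sub>R f b) \<le> k * norm (l + m)"
      by (simp add: k_def sum_distrib_right s_def)
    moreover have "(\<Sum>b\<in>B. c b *\<^sub>R f b) \<in> L" "(\<Sum>b\<in>B. c b *\<^sub>R g b) \<in> M"
      using fg by (auto intro!: subspace_sum subspace_scale L M)
    ultimately show ?thesis using s unfolding s_def by blast
  qed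
  then show ?thesis unfolding open_sum_def using k by blast
qed

text \<open>The Baire half of the open mapping theorem. The sums with first summand of norm at most
  n have closures covering the complete space L + M, so one closure has interior; linearity moves
  that ball to the origin and to every scale.\<close>

lemma approximate_decomposition:
  fixes L :: "'a::{real_inner, complete_space} set"
  assumes L: "subspace L" and M: "subspace M" and cl: "closed {l + m | l m. l \<in> L \<and> m \<in> M}"
  shows "\<exists>k\<ge>0. \<forall>s\<in>{l + m | l m. l \<in> L \<and> m \<in> M}. \<exists>l\<in>L. \<exists>m\<in>M.
           norm l \<le> k * norm s \<and> norm (s - (l + m)) \<le> norm s / 2"
proof -
  define S where "S = {l + m | l m. l \<in> L \<and> m \<in> M}"
  define V where "V n = {l + m | l m. l \<in> L \<and> m \<in> M \<and> norm l \<le> real n}" for n :: nat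
  have S: "subspace S" unfolding S_def by (rule subspace_sums[OF L M])
  have clS: "closed S" using cl unfolding S_def .
  have VS: "closure (V n) \<subseteq> S" for n
    by (rule closure_minimal[OF _ clS]) (auto simp: V_def S_def)
  have cover: "S = (\<Union>n. closure (V n))"
  proof
    show "S \<subseteq> (\<Union>n. closure (V n))"
    proof
      fix s assume "s \<in> S"
      then obtain l m where lm: "s = l + m" "l \<in> L" "m \<in> M" unfolding S_def by blast
      obtain n where "norm l \<le> real n" using real_arch_simple by blast
      then have "s \<in> V n" unfolding V_def using lm by blast
      then show "s \<in> (\<Union>n. closure (V n))" using closure_subset by blast
    qed
  qed (use VS in blast)
  let ?X = "top_of_set S"
  have cm: "completely_metrizable_space ?X"
    by (rule completely_metrizable_space_closedin[OF completely_metrizable_space_euclidean]) (use clS in simp)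
  have "\<exists>n. ?X interior_of (closure (V n)) \<noteq> {}"
  proof (rule ccontr)
    assume "\<not> ?thesis"
    then have "?X interior_of (\<Union> (range (\<lambda>n. closure (V n)))) = {}"
      by (intro Baire_category_alt) (use cm VS in \<open>auto simp: closedin_closed_eq clS\<close>)
    moreover have "?X interior_of S = S" using interior_of_topspace[of ?X] by simp
    moreover have "0 \<in> S" by (rule subspace_0[OF S])
    ultimately show False unfolding cover[symmetric] by simp
  qed
  then obtain n s0 where s0: "s0 \<in> ?X interior_of (closure (V n))" by blast
  then obtain T where T: "openin ?X T" "s0 \<in> T" "T \<subseteq> closure (V n)" by (auto simp: interior_of_def)
  then obtain e where e: "e > 0" "ball s0 e \<inter> S \<subseteq> T" unfolding openin_contains_ball by blast
  have s0S: "s0 \<in> S" using T(2,3) VS by blast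
  \<comment> \<open>Approximants of \<open>s0 + s\<close> and of \<open>s0\<close> are subtracted,
    which centres the ball at 0 and doubles the bound n on the first summand.\<close>
  have small: "\<exists>l\<in>L. \<exists>m\<in>M. norm l \<le> 2 * real n \<and> norm (s - (l + m)) < d"
    if s: "s \<in> S" "norm s < e" and d: "d > 0" for s d
  proof -
    have "s0 + s \<in> ball s0 e" "s0 + s \<in> S" using s s0S subspace_add[OF S] by (auto simp: dist_norm)
    then have "s0 + s \<in> closure (V n)" "s0 \<in> closure (V n)" using e(2) T by auto
    then obtain v w where v: "v \<in> V n" "dist v (s0 + s) < d / 2" and w: "w \<in> V n" "dist w s0 < d / 2"
      unfolding closure_approachable using d half_gt_zero by blast
    obtain l1 m1 where 1: "v = l1 + m1" "l1 \<in> L" "m1 \<in> M" "norm l1 \<le> real n" using v(1) unfolding V_def by blast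
    obtain l2 m2 where 2: "w = l2 + m2" "l2 \<in> L" "m2 \<in> M" "norm l2 \<le> real n" using w(1) unfolding V_def by blast
    have "l1 - l2 \<in> L" "m1 - m2 \<in> M" using 1 2 L M by (auto intro: subspace_diff)
    moreover have "norm (l1 - l2) \<le> 2 * real n" using norm_triangle_ineq4[of l1 l2] 1 2 by linarith
    moreover have "norm (s - ((l1 - l2) + (m1 - m2))) < d"
    proof -
      have eq: "s - ((l1 - l2) + (m1 - m2)) = (s0 + s - v) - (s0 - w)" unfolding 1 2 by (simp add: algebra_simps)
      show ?thesis unfolding eq using norm_triangle_ineq4[of "s0 + s - v" "s0 - w"] v(2) w(2)
        by (simp add: dist_norm norm_minus_commute)
    qed
    ultimately show ?thesis by blast
  qed
  define k where "k = 4 * real n / e"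
  have "\<exists>l\<in>L. \<exists>m\<in>M. norm l \<le> k * norm s \<and> norm (s - (l + m)) \<le> norm s / 2" if s: "s \<in> S" for s
  proof (cases "s = 0")
    case True
    then show ?thesis using subspace_0[OF L] subspace_0[OF M] by force
  next
    case False
    \<comment> \<open>Scaling s to norm e/2 puts it inside the ball. An error below e/4 becomes half
      of \<open>norm s\<close> after scaling back, and the bound 2n becomes
      \<open>k * norm s\<close>.\<close>
    define c where "c = e / (2 * norm s)"
    have c: "c > 0" "c * norm s = e / 2" using e(1) False by (auto simp: c_def)
    have "c *\<^sub>R s \<in> S" "norm (c *\<^sub>R s) < e" using s S c e(1) by (auto intro: subspace_scale)
    then obtain l m where lm: "l \<in> L" "m \<in> M" "norm l \<le> 2 * real n" "norm (c *\<^sub>R s - (l + m)) < e / 4"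
      using small[of "c *\<^sub>R s" "e / 4"] e(1) by auto
    have "(1 / c) *\<^sub>R l \<in> L" "(1 / c) *\<^sub>R m \<in> M" using lm L M by (auto intro: subspace_scale)
    moreover have "norm ((1 / c) *\<^sub>R l) \<le> k * norm s"
    proof -
      have "norm ((1 / c) *\<^sub>R l) = (1 / c) * norm l" using c by simp
      also have "\<dots> \<le> (1 / c) * (2 * real n)" using lm c by (intro mult_left_mono) auto
      also have "\<dots> = k * norm s" using False e(1) by (simp add: c_def k_def)
      finally show ?thesis .
    qed
    moreover have "norm (s - ((1 / c) *\<^sub>R l + (1 / c) *\<^sub>R m)) \<le> norm s / 2"
    proof -
      have "s - ((1 / c) *\<^sub>R l + (1 / c) *\<^sub>R m) = (1 / c) *\<^sub>R (c *\<^sub>R s - (l + m))"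
        using c by (simp add: algebra_simps)
      then have "norm (s - ((1 / c) *\<^sub>R l + (1 / c) *\<^sub>R m)) = (1 / c) * norm (c *\<^sub>R s - (l + m))"
        using c by simp
      also have "\<dots> \<le> (1 / c) * (e / 4)" using lm c by (intro mult_left_mono) auto
      also have "\<dots> = norm s / 2" using False e(1) by (simp add: c_def)
      finally show ?thesis .
    qed
    ultimately show ?thesis by blast
  qed
  moreover have "k \<ge> 0" using e(1) by (simp add: k_def)
  ultimately show ?thesis unfolding S_def[symmetric] by blast
qed

text \<open>Successive approximation: the residual r is split again and again, its norm halves each
  time, and the first summands form a convergent series. The factor 2 in the final constant is the
  sum of the geometric series with ratio 1/2.\<close>

lemma open_sum_closed:
  fixes L :: "'a::{real_inner, complete_space} set"
  assumes L: "subspace L" "closed L" and M: "subspace M" "closed M"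
    and cl: "closed {l + m | l m. l \<in> L \<and> m \<in> M}"
  shows "open_sum L M"
proof -
  define S where "S = {l + m | l m. l \<in> L \<and> m \<in> M}"
  have S: "subspace S" unfolding S_def by (rule subspace_sums[OF L(1) M(1)])
  obtain k where k: "k \<ge> 0" and "\<forall>s\<in>S. \<exists>l\<in>L. \<exists>m\<in>M.
           norm l \<le> k * norm s \<and> norm (s - (l + m)) \<le> norm s / 2"
    using approximate_decomposition[OF L(1) M(1) cl] unfolding S_def by blast
  then obtain f g where fg: "\<And>s. s \<in> S \<Longrightarrow> f s \<in> L" "\<And>s. s \<in> S \<Longrightarrow> g s \<in> M"
    "\<And>s. s \<in> S \<Longrightarrow> norm (f s) \<le> k * norm s" "\<And>s. s \<in> S \<Longrightarrow> norm (s - (f s + g s)) \<le> norm s / 2"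
    by metis
  have "\<exists>l\<in>L. \<exists>m\<in>M. s = l + m \<and> norm l \<le> (2 * k) * norm s" if s: "s \<in> S" for s
  proof -
    define r where "r n = ((\<lambda>t. t - (f t + g t)) ^^ n) s" for n
    define y where "y n = (\<Sum>j<n. f (r j))" for n
    have r0: "r 0 = s" and rS: "r (Suc n) = r n - (f (r n) + g (r n))" for n by (simp_all add: r_def)
    have fgS: "f t + g t \<in> S" if "t \<in> S" for t unfolding S_def using fg(1,2)[OF that] by blast
    have r: "r n \<in> S" for n by (induction n) (auto simp: r0 rS s intro: subspace_diff[OF S] fgS)
    have rn: "norm (r n) \<le> norm s * (1/2) ^ n" for n
    proof (induction n)
      case (Suc n)
      then show ?case using fg(4)[OF r[of n]] unfolding rS by simp
    qed (simp add: r0)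
    have "dist (y (Suc n)) (y n) \<le> k * norm s * (1/2) ^ n" for n
      using order_trans[OF fg(3)[OF r[of n]] mult_left_mono[OF rn[of n] k]]
      by (simp add: y_def dist_norm mult.assoc)
    from convergent_of_geometric_steps[OF _ _ this]
    obtain l where l: "y \<longlonglongrightarrow> l" "\<And>n. dist (y n) l \<le> k * norm s / (1 - 1/2) * (1/2) ^ n" by auto
    have lL: "l \<in> L"
      by (rule closed_sequentially[OF L(2) _ l(1)]) (use fg(1) r in \<open>auto simp: y_def intro: subspace_sum[OF L(1)]\<close>)
    have "(\<lambda>n. norm s * (1/2) ^ n) \<longlonglongrightarrow> 0"
      by (intro tendsto_mult_right_zero LIMSEQ_power_zero) auto
    then have "r \<longlonglongrightarrow> 0" by (rule Lim_null_comparison[rotated]) (simp add: rn)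
    then have lim: "(\<lambda>n. s - y n - r n) \<longlonglongrightarrow> s - l - 0" by (intro tendsto_intros l)
    \<comment> \<open>What is left of s is a partial sum of elements of M, so closedness of M
      settles the second summand and its series needs no convergence argument of its own.\<close>
    have "s - y n - r n = (\<Sum>j<n. g (r j))" for n
    proof (induction n)
      case (Suc n)
      have "s - y (Suc n) - r (Suc n) = (s - y n - r n) + g (r n)" unfolding rS by (simp add: y_def)
      then show ?case by (simp only: Suc) simp
    qed (simp add: y_def r0)
    then have "s - y n - r n \<in> M" for n using fg(2) r by (auto intro: subspace_sum[OF M(1)])
    then have "s - l \<in> M" using closed_sequentially[OF M(2) _ lim] by simp
    moreover have "norm l \<le> 2 * k * norm s" using l(2)[of 0] by (simp add: y_def dist_norm)
    ultimately show ?thesis using lL by (intro bexI[of _ l] bexI[of _ "s - l"]) auto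
  qed
  moreover have "l + m \<in> S" if "l \<in> L" "m \<in> M" for l m unfolding S_def using that by blast
  ultimately show ?thesis unfolding open_sum_def using k
    by (intro exI[of _ "2 * k"] conjI ballI) auto
qed

section \<open>Cyclic compositions\<close>

lemma le_infdistI:
  assumes "S \<noteq> {}" "\<And>z. z \<in> S \<Longrightarrow> d \<le> dist x z"
  shows "d \<le> infdist x S"
  unfolding infdist_notempty[OF assms(1)] by (rule cINF_greatest[OF assms(1)]) (rule assms(2))

text \<open>T need not be continuous: fixed points tending to l are at most as far from
  \<open>T l\<close> as from l, hence they tend to \<open>T l\<close> as well.\<close>

lemma closed_Fix_quasi_nonexpansive:
  fixes T :: "'a::real_normed_vector \<Rightarrow> 'a"
  assumes T: "\<And>x z. z \<in> Fix T \<Longrightarrow> norm (T x - z) \<le> norm (x - z)"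
  shows "closed (Fix T)"
  unfolding closed_sequential_limits
proof (intro allI impI, elim conjE)
  fix u l assume u: "\<forall>n. u n \<in> Fix T" "u \<longlonglongrightarrow> l"
  have "(\<lambda>n. norm (l - u n)) \<longlonglongrightarrow> 0"
    using u(2) by (simp add: LIMSEQ_def dist_norm norm_minus_commute[of l])
  then have "(\<lambda>n. T l - u n) \<longlonglongrightarrow> 0"
    by (rule Lim_null_comparison[rotated]) (use T u(1) in simp)
  then have "u \<longlonglongrightarrow> T l" by (simp add: LIMSEQ_def dist_norm norm_minus_commute[of "T l"])
  from LIMSEQ_unique[OF this u(2)] show "l \<in> Fix T" by (simp add: Fix_def)
qed

text \<open>If a sweep barely lowers the squared distance to Z, all its displacements are small; the
  error bounds then put x near every fixed point set, and regularity puts it near Z. Quantified, the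
  drop is a fixed fraction of the squared distance to Z. The constants are valid on bounded sets
  only, hence the radius R around \<open>z0\<close>.\<close>

lemma cyclic_composition_contracts:
  fixes T :: "nat \<Rightarrow> 'a::real_normed_vector \<Rightarrow> 'a" and m :: nat
  defines "Z \<equiv> \<Inter>i\<in>{1..m}. Fix (T i)"
  assumes m: "m \<ge> 1"
    and qfne: "\<And>i x z. i \<in> {1..m} \<Longrightarrow> z \<in> Fix (T i) \<Longrightarrow>
        (norm (T i x - z))\<^sup>2 + (norm (x - T i x))\<^sup>2 \<le> (norm (x - z))\<^sup>2"
    and err: "\<And>i \<rho>. i \<in> {1..m} \<Longrightarrow> \<exists>k\<ge>0. \<forall>x. norm x \<le> \<rho> \<longrightarrow> infdist x (Fix (T i)) \<le> k * norm (x - T i x)"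
    and reg: "bdd_lin_regular {1..m} (\<lambda>i. Fix (T i))"
    and z0: "z0 \<in> Z"
  shows "\<exists>q. 0 \<le> q \<and> q < 1 \<and> (\<forall>x. norm (x - z0) \<le> R \<longrightarrow>
      infdist (comp_upto T m x) Z \<le> q * infdist x Z)"
    and "z \<in> Z \<Longrightarrow> norm (comp_upto T m x - z) \<le> norm (x - z)"
proof -
  have fejer: "(norm (comp_upto T j x - z))\<^sup>2 + (\<Sum>i<j. (norm (comp_upto T i x - comp_upto T (Suc i) x))\<^sup>2) \<le> (norm (x - z))\<^sup>2"
    if "z \<in> Z" "j \<le> m" for j x z
    using that(2)
  proof (induction j)
    case (Suc j)
    then show ?case using qfne[of "Suc j" z "comp_upto T j x"] that(1) by (force simp: Z_def)
  qed simp
  have mono: "norm (comp_upto T j x - z) \<le> norm (x - z)" if "z \<in> Z" "j \<le> m" for j x z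
  proof (rule power2_le_imp_le)
    have "0 \<le> (\<Sum>i<j. (norm (comp_upto T i x - comp_upto T (Suc i) x))\<^sup>2)" by (intro sum_nonneg) auto
    then show "(norm (comp_upto T j x - z))\<^sup>2 \<le> (norm (x - z))\<^sup>2" using fejer[OF that, of x] by linarith
  qed simp
  then show "z \<in> Z \<Longrightarrow> norm (comp_upto T m x - z) \<le> norm (x - z)" by simp
  \<comment> \<open>By monotonicity towards \<open>z0\<close>, all intermediate points of a sweep
    started within R of \<open>z0\<close> stay in this ball. The absolute value and the 1 keep the
    radius positive for every R.\<close>
  define \<rho> where "\<rho> = \<bar>R\<bar> + norm z0 + 1"
  have \<rho>: "\<rho> > 0" by (simp add: \<rho>_def add_nonneg_pos)
  obtain k where k: "\<And>i. i \<in> {1..m} \<Longrightarrow> k i \<ge> 0"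
    "\<And>i x. i \<in> {1..m} \<Longrightarrow> norm x \<le> \<rho> \<Longrightarrow> infdist x (Fix (T i)) \<le> k i * norm (x - T i x)"
    using err[of _ \<rho>] by metis
  obtain \<mu> where \<mu>: "\<mu> > 0" "\<And>x. norm x \<le> \<rho> \<Longrightarrow>
      infdist x Z \<le> \<mu> * Max ((\<lambda>i. infdist x (Fix (T i))) ` {1..m})"
    using reg \<rho> unfolding bdd_lin_regular_def Z_def by metis
  define K where "K = (\<Sum>i\<in>{1..m}. k i)"
  \<comment> \<open>The term K + 1 pays for the error bound at an intermediate point plus the path
    leading to it, and the factor m comes from Cauchy-Schwarz for the sum of m displacements. The
    final 1 gives M \<ge> 1, so that 1 - 1/M is a valid factor under the root.\<close>
  define M where "M = (\<mu> * (K + 1))\<^sup>2 * real m + 1"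
  have K0: "K \<ge> 0" unfolding K_def by (intro sum_nonneg k)
  have kK: "k i \<le> K" if "i \<in> {1..m}" for i unfolding K_def by (rule member_le_sum) (use that k in auto)
  have M: "M \<ge> 1" unfolding M_def by simp
  have step: "infdist (comp_upto T m x) Z \<le> sqrt (1 - 1 / M) * infdist x Z" if xR: "norm (x - z0) \<le> R" for x
  proof -
    define d where "d i = norm (comp_upto T i x - comp_upto T (Suc i) x)" for i
    define D where "D = (\<Sum>i<m. d i)"
    have d0: "d i \<ge> 0" for i by (simp add: d_def)
    have bound: "norm (comp_upto T j x) \<le> \<rho>" if "j \<le> m" for j
      using mono[OF z0 that, of x] xR norm_triangle_sub[of "comp_upto T j x" z0] by (simp add: \<rho>_def)
    have path: "dist x (comp_upto T j x) \<le> (\<Sum>i<j. d i)" for j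
    proof (induction j)
      case (Suc j)
      then show ?case using dist_triangle[of x "comp_upto T (Suc j) x" "comp_upto T j x"]
        by (simp add: d_def dist_norm del: comp_upto.simps)
    qed simp
    have each: "infdist x (Fix (T i)) \<le> (K + 1) * D" if i: "i \<in> {1..m}" for i
    proof -
      obtain j where j: "i = Suc j" using i by (cases i) auto
      have "infdist x (Fix (T i)) \<le> infdist (comp_upto T j x) (Fix (T i)) + dist x (comp_upto T j x)"
        by (rule infdist_triangle)
      also have "infdist (comp_upto T j x) (Fix (T i)) \<le> k i * d j"
        using k(2)[OF i bound[of j]] i j by (simp add: d_def)
      also have "\<dots> \<le> K * D"
      proof (intro mult_mono)
        show "d j \<le> D" unfolding D_def by (rule member_le_sum) (use i j d0 in auto)
      qed (use kK i K0 d0 in auto)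
      also have "dist x (comp_upto T j x) \<le> D"
        by (rule order_trans[OF path]) (use i j d0 in \<open>auto simp: D_def intro!: sum_mono2\<close>)
      finally show ?thesis by (simp add: algebra_simps)
    qed
    have "Max ((\<lambda>i. infdist x (Fix (T i))) ` {1..m}) \<le> (K + 1) * D"
      using m each by (subst Max_le_iff) auto
    then have "infdist x Z \<le> \<mu> * ((K + 1) * D)"
      using order_trans[OF \<mu>(2)[of x] mult_left_mono] bound[of 0] \<mu>(1) by simp
    then have "(infdist x Z)\<^sup>2 \<le> (\<mu> * ((K + 1) * D))\<^sup>2" by (rule power_mono) (rule infdist_nonneg)
    also have "\<dots> = (\<mu> * (K + 1))\<^sup>2 * D\<^sup>2" by (simp add: power_mult_distrib)
    also have "\<dots> \<le> (\<mu> * (K + 1))\<^sup>2 * (real m * (\<Sum>i<m. (d i)\<^sup>2))"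
    proof (rule mult_left_mono)
      show "D\<^sup>2 \<le> real m * (\<Sum>i<m. (d i)\<^sup>2)"
        using sum_squared_le_sum_of_squares[of d "{..<m}"] unfolding D_def by (simp add: mult.commute)
    qed simp
    also have "\<dots> \<le> M * (\<Sum>i<m. (d i)\<^sup>2)" by (simp add: M_def algebra_simps sum_nonneg)
    finally have "(infdist x Z)\<^sup>2 / M \<le> (\<Sum>i<m. (d i)\<^sup>2)" using M by (simp add: field_simps)
    then have sq: "(norm (comp_upto T m x - z))\<^sup>2 + (infdist x Z)\<^sup>2 / M \<le> (norm (x - z))\<^sup>2" if "z \<in> Z" for z
      using fejer[OF that order_refl, of x] unfolding d_def by linarith
    \<comment> \<open>The estimate \<open>sq\<close> holds for each z in Z. As
      \<open>infdist\<close> is an infimum of unsquared distances, the root is taken before passing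
      to the infimum and removed afterwards.\<close>
    let ?u = "infdist (comp_upto T m x) Z"
    have "sqrt (?u\<^sup>2 + (infdist x Z)\<^sup>2 / M) \<le> infdist x Z"
    proof (rule le_infdistI)
      fix z assume z: "z \<in> Z"
      have "?u\<^sup>2 \<le> (norm (comp_upto T m x - z))\<^sup>2"
        using infdist_le[OF z, of "comp_upto T m x"] by (intro power_mono) (auto simp: dist_norm infdist_nonneg)
      then have "?u\<^sup>2 + (infdist x Z)\<^sup>2 / M \<le> (dist x z)\<^sup>2" using sq[OF z] by (simp add: dist_norm)
      then show "sqrt (?u\<^sup>2 + (infdist x Z)\<^sup>2 / M) \<le> dist x z" by (intro real_le_lsqrt) auto
    qed (use z0 in auto)
    then have "?u\<^sup>2 + (infdist x Z)\<^sup>2 / M \<le> (infdist x Z)\<^sup>2"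
      by (rule sqrt_le_D)
    then have "?u\<^sup>2 \<le> (1 - 1 / M) * (infdist x Z)\<^sup>2" by (simp add: algebra_simps)
    then have "sqrt (?u\<^sup>2) \<le> sqrt ((1 - 1 / M) * (infdist x Z)\<^sup>2)" by (rule real_sqrt_le_mono)
    then show ?thesis by (simp add: real_sqrt_mult infdist_nonneg)
  qed
  have "0 \<le> sqrt (1 - 1 / M)" "sqrt (1 - 1 / M) < 1" using M by auto
  then show "\<exists>q. 0 \<le> q \<and> q < 1 \<and> (\<forall>x. norm (x - z0) \<le> R \<longrightarrow>
      infdist (comp_upto T m x) Z \<le> q * infdist x Z)"
    using step by blast
qed

lemma cyclic_composition_lin_conv:
  fixes T :: "nat \<Rightarrow> 'a::{real_inner, complete_space} \<Rightarrow> 'a" and m :: nat and x :: "nat \<Rightarrow> 'a"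
  assumes m: "m \<ge> 1"
    and qfne: "\<And>i x z. i \<in> {1..m} \<Longrightarrow> z \<in> Fix (T i) \<Longrightarrow>
        (norm (T i x - z))\<^sup>2 + (norm (x - T i x))\<^sup>2 \<le> (norm (x - z))\<^sup>2"
    and err: "\<And>i \<rho>. i \<in> {1..m} \<Longrightarrow> \<exists>k\<ge>0. \<forall>x. norm x \<le> \<rho> \<longrightarrow> infdist x (Fix (T i)) \<le> k * norm (x - T i x)"
    and reg: "bdd_lin_regular {1..m} (\<lambda>i. Fix (T i))"
    and iter: "\<And>n. x (Suc n) = comp_upto T m (x n)"
  shows "\<exists>xb. xb \<in> (\<Inter>i\<in>{1..m}. Fix (T i)) \<and> lin_conv x xb"
proof -
  define Z where "Z = (\<Inter>i\<in>{1..m}. Fix (T i))"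
  obtain z0 where z0: "z0 \<in> Z" using reg unfolding bdd_lin_regular_def Z_def by blast
  have "closed (Fix (T i))" if "i \<in> {1..m}" for i
  proof (rule closed_Fix_quasi_nonexpansive)
    fix y z assume "z \<in> Fix (T i)"
    from qfne[OF that this, of y] have "(norm (T i y - z))\<^sup>2 \<le> (norm (y - z))\<^sup>2"
      by (smt (verit) zero_le_power2)
    then show "norm (T i y - z) \<le> norm (y - z)" by (rule power2_le_imp_le) simp
  qed
  then have clZ: "closed Z" unfolding Z_def by auto
  \<comment> \<open>The rate depends on the starting point through the radius
    \<open>norm (x 0 - z0)\<close>; \<open>near\<close> shows that the iterates never leave this
    ball.\<close>
  have "\<exists>q. 0 \<le> q \<and> q < 1 \<and> (\<forall>y. norm (y - z0) \<le> norm (x 0 - z0) \<longrightarrow>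
      infdist (comp_upto T m y) Z \<le> q * infdist y Z)"
    unfolding Z_def by (rule cyclic_composition_contracts(1)[OF m])
      ((fact qfne err reg z0[unfolded Z_def])+)
  then obtain q where q: "0 \<le> q" "q < 1" "\<And>y. norm (y - z0) \<le> norm (x 0 - z0) \<Longrightarrow>
      infdist (comp_upto T m y) Z \<le> q * infdist y Z"
    by blast
  have mono: "norm (comp_upto T m y - z) \<le> norm (y - z)" if "z \<in> Z" for y z
    by (rule cyclic_composition_contracts(2)[OF m])
      ((fact qfne err reg z0[unfolded Z_def] that[unfolded Z_def])+)
  have near: "norm (x n - z0) \<le> norm (x 0 - z0)" for n
  proof (induction n)
    case (Suc n)
    then show ?case using mono[OF z0, of "x n"] unfolding iter by linarith
  qed simp
  have geo: "infdist (x n) Z \<le> infdist (x 0) Z * q ^ n" for n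
  proof (induction n)
    case (Suc n)
    have "infdist (x (Suc n)) Z \<le> q * infdist (x n) Z" unfolding iter by (rule q(3)[OF near])
    also have "\<dots> \<le> q * (infdist (x 0) Z * q ^ n)" by (intro mult_left_mono Suc q)
    finally show ?case by (simp add: algebra_simps)
  qed simp
  \<comment> \<open>Both consecutive iterates are within \<open>dist (x n) z\<close> of any z in Z.
    Thus step lengths inherit the geometric decay of the distance to Z, and the iterates themselves
    converge.\<close>
  have "dist (x (Suc n)) (x n) / 2 \<le> infdist (x n) Z" for n
  proof (rule le_infdistI)
    fix z assume "z \<in> Z"
    from mono[OF this, of "x n"] show "dist (x (Suc n)) (x n) / 2 \<le> dist (x n) z"
      using dist_triangle2[of "x (Suc n)" "x n" z] unfolding iter by (simp add: dist_norm)
  qed (use z0 in auto)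
  from order_trans[OF this geo] have "dist (x (Suc n)) (x n) \<le> 2 * infdist (x 0) Z * q ^ n" for n
    by (simp add: mult_ac)
  from convergent_of_geometric_steps[OF q(1,2) this]
  obtain l where l: "x \<longlonglongrightarrow> l" "\<And>n. dist (x n) l \<le> 2 * infdist (x 0) Z / (1 - q) * q ^ n" by blast
  have "(\<lambda>n. infdist (x 0) Z * q ^ n) \<longlonglongrightarrow> 0"
    using q by (intro tendsto_mult_right_zero LIMSEQ_power_zero) auto
  then have "(\<lambda>n. infdist (x n) Z) \<longlonglongrightarrow> 0"
    by (rule Lim_null_comparison[rotated]) (simp add: geo infdist_nonneg)
  moreover have "(\<lambda>n. infdist (x n) Z) \<longlonglongrightarrow> infdist l Z" by (intro tendsto_infdist l)
  ultimately have "infdist l Z = 0" using LIMSEQ_unique by blast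
  then have "l \<in> Z" using in_closed_iff_infdist_zero[OF clZ] z0 by blast
  moreover have "lin_conv x l"
    unfolding lin_conv_def using q l(2) infdist_nonneg[of "x 0" Z]
    by (intro exI[of _ "2 * infdist (x 0) Z / (1 - q)"] exI[of _ q]) (auto simp: dist_norm)
  ultimately show ?thesis unfolding Z_def by blast
qed

section \<open>Fixed points of the Douglas--Rachford operator\<close>

text \<open>An input abbreviation, so that terms written with it are literally the lambda terms of
  the final statement.\<close>

abbreviation (input) dr :: "'a::real_inner set \<Rightarrow> 'a set \<Rightarrow> 'a \<Rightarrow> 'a" where
  "dr A B \<equiv> \<lambda>y. proj B (reflector A y) + y - proj A y"

text \<open>For a fixed point z the point a' = \<open>proj A z\<close> lies in both sets. The four
  obtuse-angle inequalities for the pairs a, a' in A and b, a' in B add up to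
  \<open>(a - b) \<bullet> (a - b) \<le> (x - z) \<bullet> (a - b)\<close>, where a - b is the
  displacement of x.\<close>

lemma dr_quasi_firmly_nonexpansive:
  fixes A :: "'a::{real_inner, complete_space} set"
  assumes A: "closed A" "convex A" "A \<noteq> {}" and B: "closed B" "convex B" "B \<noteq> {}"
    and z: "z \<in> Fix (dr A B)"
  shows "(norm (dr A B x - z))\<^sup>2 + (norm (x - dr A B x))\<^sup>2 \<le> (norm (x - z))\<^sup>2"
proof -
  define a b a' where "a = proj A x" and "b = proj B (reflector A x)" and "a' = proj A z"
  have b': "proj B (reflector A z) = a'" using z by (simp add: Fix_def a'_def)
  have r: "reflector A x = 2 *\<^sub>R a - x" "reflector A z = 2 *\<^sub>R a' - z"
    by (simp_all add: reflector_def a_def a'_def)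
  have in_A: "a \<in> A" "a' \<in> A" unfolding a_def a'_def by (rule proj_in[OF A])+
  have in_B: "b \<in> B" "a' \<in> B" unfolding b_def b'[symmetric] by (rule proj_in[OF B])+
  have "(x - a) \<bullet> (a' - a) \<le> 0" "(z - a') \<bullet> (a - a') \<le> 0"
    "(2 *\<^sub>R a - x - b) \<bullet> (a' - b) \<le> 0" "(2 *\<^sub>R a' - z - a') \<bullet> (b - a') \<le> 0"
    using proj_obtuse[OF A in_A(2), of x] proj_obtuse[OF A in_A(1), of z]
      proj_obtuse[OF B in_B(2), of "reflector A x"] proj_obtuse[OF B in_B(1), of "reflector A z"]
    unfolding b' b_def[symmetric] unfolding a_def[symmetric] a'_def[symmetric] r by blast+
  then have "(a - b) \<bullet> (a - b) \<le> (x - z) \<bullet> (a - b)"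
    by (simp add: inner_diff_left inner_diff_right inner_commute algebra_simps)
  then have "(norm ((x - z) - (a - b)))\<^sup>2 + (norm (a - b))\<^sup>2 \<le> (norm (x - z))\<^sup>2"
    unfolding power2_norm_eq_inner by (simp add: inner_diff_left inner_diff_right inner_commute algebra_simps)
  moreover have "dr A B x - z = (x - z) - (a - b)" "x - dr A B x = a - b"
    by (simp_all add: a_def b_def)
  ultimately show ?thesis by (simp only:)
qed

text \<open>A constraint qualification in quantitative form: 0 is interior to A - B relative to S.
  The bound \<rho> on a also bounds b = a - s, so both test points used in the error estimate are
  controlled.\<close>

definition relatively_absorbing :: "'a::real_inner set \<Rightarrow> 'a set \<Rightarrow> 'a set \<Rightarrow> bool" where
  "relatively_absorbing S A B \<longleftrightarrow> subspace S \<and> orth_decomposable S \<and> (\<forall>a\<in>A. \<forall>b\<in>B. a - b \<in> S) \<and>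
     (\<exists>r>0. \<exists>\<rho>. \<forall>s\<in>S. norm s \<le> r \<longrightarrow> (\<exists>a\<in>A. \<exists>b\<in>B. s = a - b \<and> norm a \<le> \<rho>))"

text \<open>At a fixed point y with p = \<open>proj A y\<close>, the two variational inequalities
  add to \<open>(y - p) \<bullet> (a - b) \<le> 0\<close>. Since A - B contains a ball of S, scaling
  extends this to all of S, and testing with s and -s gives orthogonality. Conversely, u orthogonal
  to S is orthogonal to a - c and b - c, so c is the projection in both steps.\<close>

lemma Fix_dr:
  fixes A :: "'a::{real_inner, complete_space} set"
  assumes A: "closed A" "convex A" and B: "closed B" "convex B" and S: "relatively_absorbing S A B"
  shows "Fix (dr A B) = {c + u | c u. c \<in> A \<inter> B \<and> (\<forall>s\<in>S. u \<bullet> s = 0)}"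
proof (intro set_eqI iffI)
  obtain r \<rho> where sub: "subspace S" and diff: "\<And>a b. a \<in> A \<Longrightarrow> b \<in> B \<Longrightarrow> a - b \<in> S" and r: "r > 0"
    and abs: "\<And>s. s \<in> S \<Longrightarrow> norm s \<le> r \<Longrightarrow> \<exists>a\<in>A. \<exists>b\<in>B. s = a - b \<and> norm a \<le> \<rho>"
    using S unfolding relatively_absorbing_def by metis
  have "0 \<in> S" using sub by (rule subspace_0)
  then have ne: "A \<noteq> {}" "B \<noteq> {}" using abs[of 0] r by auto
  {
    fix y assume y: "y \<in> Fix (dr A B)"
    define p where "p = proj A y"
    have pB: "proj B (reflector A y) = p" using y by (simp add: Fix_def p_def)
    have in_A: "p \<in> A" unfolding p_def by (rule proj_in[OF A ne(1)])
    have in_B: "p \<in> B" unfolding pB[symmetric] by (rule proj_in[OF B ne(2)])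
    have rf: "reflector A y = 2 *\<^sub>R p - y" by (simp add: reflector_def p_def)
    have le: "(y - p) \<bullet> (a - b) \<le> 0" if "a \<in> A" "b \<in> B" for a b
    proof -
      have "(y - p) \<bullet> (a - p) \<le> 0" using proj_obtuse[OF A ne(1) that(1), of y] by (simp add: p_def)
      moreover have "(2 *\<^sub>R p - y - p) \<bullet> (b - p) \<le> 0"
        using proj_obtuse[OF B ne(2) that(2), of "reflector A y"] unfolding pB unfolding rf .
      ultimately show ?thesis by (simp add: inner_diff_left inner_diff_right)
    qed
    have le_S: "(y - p) \<bullet> s \<le> 0" if s: "s \<in> S" for s
    proof (cases "s = 0")
      case False
      define c where "c = r / norm s"
      have c: "c > 0" using False r by (simp add: c_def)
      have "c *\<^sub>R s \<in> S" "norm (c *\<^sub>R s) \<le> r"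
        using False r s sub by (auto simp: c_def intro: subspace_scale)
      then obtain a b where "a \<in> A" "b \<in> B" "c *\<^sub>R s = a - b" using abs by blast
      with le have "(y - p) \<bullet> (c *\<^sub>R s) \<le> 0" by metis
      then show ?thesis using c by (simp add: mult_le_0_iff)
    qed simp
    have "(y - p) \<bullet> s = 0" if "s \<in> S" for s
      using le_S[OF that] le_S[OF subspace_neg[OF sub that]] by simp
    then show "y \<in> {c + u | c u. c \<in> A \<inter> B \<and> (\<forall>s\<in>S. u \<bullet> s = 0)}"
      using in_A in_B by (intro CollectI exI[of _ p] exI[of _ "y - p"]) auto
  next
    fix y assume "y \<in> {c + u | c u. c \<in> A \<inter> B \<and> (\<forall>s\<in>S. u \<bullet> s = 0)}"
    then obtain c u where y: "y = c + u" and c: "c \<in> A" "c \<in> B" and u: "\<And>s. s \<in> S \<Longrightarrow> u \<bullet> s = 0" by blast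
    have pA: "proj A y = c"
      by (rule proj_unique[OF A c(1)]) (use u diff c y in simp)
    have "u \<bullet> (b - c) = 0" if "b \<in> B" for b
      using u[OF diff[OF c(1) that]] by (simp add: inner_diff_right)
    then have "proj B (c - u) = c"
      by (intro proj_unique[OF B c(2)]) simp
    moreover have "reflector A y = c - u" unfolding reflector_def pA by (simp add: y scaleR_2)
    ultimately show "y \<in> Fix (dr A B)" by (simp add: Fix_def pA)
  }
qed

section \<open>Error bound for a single Douglas-Rachford operator\<close>

lemma relatively_absorbing_point_near:
  fixes A :: "'a::real_inner set"
  assumes A: "convex A" and B: "convex B" and sub: "subspace S" and r: "r > 0"
    and abs: "\<And>s. s \<in> S \<Longrightarrow> norm s \<le> r \<Longrightarrow> \<exists>a\<in>A. \<exists>b\<in>B. s = a - b \<and> norm a \<le> \<rho>"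
    and a: "a \<in> A" and b: "b \<in> B" and ab: "a - b \<in> S"
  shows "\<exists>c\<in>A \<inter> B. norm (c - a) \<le> (\<rho> + norm a) / r * norm (a - b)"
proof (cases "a = b")
  case True
  then show ?thesis using a b by (intro bexI[of _ a]) auto
next
  case False
  define t where "t = norm (a - b)"
  have t: "t > 0" using False by (simp add: t_def)
  \<comment> \<open>The gap a - b is compensated by a pair of bounded points whose difference points
    the opposite way with the maximal length r.\<close>
  have "-(r / t) *\<^sub>R (a - b) \<in> S" "norm (-(r / t) *\<^sub>R (a - b)) \<le> r"
    using ab sub r t by (auto intro!: subspace_scale subspace_neg simp: t_def[symmetric])
  then obtain a' b' where ab': "a' \<in> A" "b' \<in> B" "-(r / t) *\<^sub>R (a - b) = a' - b'" "norm a' \<le> \<rho>"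
    using abs by blast
  \<comment> \<open>This weight solves (1 - l) - l r/t = 0: the convex combinations of a, a' and of
    b, b' then coincide. As l \<le> t/r, the common point moves away from a by a multiple of the
    gap.\<close>
  define l where "l = t / (t + r)"
  have l: "0 \<le> l" "l \<le> 1" "l \<le> t / r" using t r by (auto simp: l_def field_simps)
  define c where "c = (1 - l) *\<^sub>R a + l *\<^sub>R a'"
  have "c \<in> A" unfolding c_def by (rule convexD[OF A a ab'(1)]) (use l in auto)
  moreover have "c = (1 - l) *\<^sub>R b + l *\<^sub>R b'"
  proof -
    have "c - ((1 - l) *\<^sub>R b + l *\<^sub>R b') = (1 - l) *\<^sub>R (a - b) + l *\<^sub>R (a' - b')"
      by (simp add: c_def algebra_simps)
    also have "\<dots> = ((1 - l) - l * (r / t)) *\<^sub>R (a - b)"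
      unfolding ab'(3)[symmetric] by (simp add: scaleR_diff_left)
    also have "(1 - l) - l * (r / t) = 0" using t r by (simp add: l_def field_simps)
    finally show ?thesis by simp
  qed
  then have "c \<in> B" using convexD[OF B b ab'(2), of "1 - l" l] l by simp
  moreover have "norm (c - a) \<le> (\<rho> + norm a) / r * norm (a - b)"
  proof -
    have "c - a = l *\<^sub>R (a' - a)" by (simp add: c_def algebra_simps)
    then have "norm (c - a) = l * norm (a' - a)" using l by simp
    also have "\<dots> \<le> (t / r) * (\<rho> + norm a)"
      using norm_triangle_ineq4[of a' a] ab'(4) l t r by (intro mult_mono) auto
    finally show ?thesis by (simp add: t_def mult.commute)
  qed
  ultimately show ?thesis by blast
qed

text \<open>With u = x - a and e = a - b the displacement, x = a + u. Replacing a by a nearby c in A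
  \<inter> B, and u by its part u - p orthogonal to S, yields a fixed point. Both corrections, c - a
  and p, are at most a multiple of \<open>norm e\<close>.\<close>

lemma dr_error_bound:
  fixes A :: "'a::{real_inner, complete_space} set"
  assumes A: "closed A" "convex A" and B: "closed B" "convex B" and S: "relatively_absorbing S A B"
  shows "\<exists>k\<ge>0. \<forall>x. norm x \<le> R \<longrightarrow> infdist x (Fix (dr A B)) \<le> k * norm (x - dr A B x)"
proof (cases "R \<ge> 0")
  case False
  then have "\<not> norm x \<le> R" for x :: 'a using norm_ge_zero[of x] by linarith
  then show ?thesis by auto
next
  case R: True
  obtain r \<rho> where sub: "subspace S" and orth: "orth_decomposable S"
    and diff: "\<And>a b. a \<in> A \<Longrightarrow> b \<in> B \<Longrightarrow> a - b \<in> S" and r: "r > 0"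
    and abs: "\<And>s. s \<in> S \<Longrightarrow> norm s \<le> r \<Longrightarrow> \<exists>a\<in>A. \<exists>b\<in>B. s = a - b \<and> norm a \<le> \<rho>"
    using S unfolding relatively_absorbing_def by metis
  have "0 \<in> S" using sub by (rule subspace_0)
  then obtain c0 where c0: "c0 \<in> A" "c0 \<in> B" "norm c0 \<le> \<rho>" using abs[of 0] r by auto
  then have ne: "A \<noteq> {}" "B \<noteq> {}" by auto
  have \<rho>: "\<rho> \<ge> 0" using c0(3) norm_ge_zero[of c0] by linarith
  \<comment> \<open>The sum of the bounds R + \<rho> on u, \<rho> + r on b' and 10 R + 5 \<rho> on
    b; it also dominates \<rho> + \<open>norm a\<close>.\<close>
  define N where "N = 11 * R + 7 * \<rho> + r"
  have N: "N \<ge> 0" using R \<rho> r by (simp add: N_def)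
  define k where "k = 2 * (N / r)"
  have "infdist x (Fix (dr A B)) \<le> k * norm (x - dr A B x)" if x: "norm x \<le> R" for x
  proof -
    define a b where "a = proj A x" and "b = proj B (reflector A x)"
    define u e where "u = x - a" and "e = a - b"
    have in_A: "a \<in> A" unfolding a_def by (rule proj_in[OF A ne(1)])
    have in_B: "b \<in> B" unfolding b_def by (rule proj_in[OF B ne(2)])
    have rf: "reflector A x = 2 *\<^sub>R a - x" by (simp add: reflector_def a_def)
    have e: "norm (x - dr A B x) = norm e" by (simp add: e_def a_def b_def)
    have un: "norm u \<le> R + \<rho>"
      using proj_nearest[OF A ne(1) c0(1), of x] norm_triangle_ineq4[of x c0] x c0(3)
      by (simp add: u_def a_def dist_norm)
    have an: "norm a \<le> 2 * R + \<rho>"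
      using norm_triangle_ineq4[of x u] un x by (simp add: u_def)
    have bn: "norm b \<le> 10 * R + 5 * \<rho>"
    proof -
      let ?w = "2 *\<^sub>R a - x"
      have "norm ?w \<le> 5 * R + 2 * \<rho>" using norm_triangle_ineq4[of "2 *\<^sub>R a" x] an x by simp
      moreover have "norm (?w - b) \<le> norm (?w - c0)"
        using proj_nearest[OF B ne(2) c0(2), of "reflector A x"] by (simp add: b_def rf dist_norm)
      moreover have "norm (?w - c0) \<le> norm ?w + norm c0" by (rule norm_triangle_ineq4)
      moreover have "norm b \<le> norm ?w + norm (?w - b)" using norm_triangle_ineq4[of ?w "?w - b"] by simp
      ultimately show ?thesis using c0(3) by linarith
    qed
    obtain p where p: "p \<in> S" "\<And>t. t \<in> S \<Longrightarrow> (u - p) \<bullet> t = 0"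
      using orth unfolding orth_decomposable_def by metis
    have pn: "norm p \<le> N / r * norm e"
    proof (cases "p = 0")
      case True
      then show ?thesis using N r by simp
    next
      case False
      have "(r / norm p) *\<^sub>R p \<in> S" "norm ((r / norm p) *\<^sub>R p) \<le> r"
        using p sub False r by (auto intro: subspace_scale)
      then obtain a' b' where ab': "a' \<in> A" "b' \<in> B" "(r / norm p) *\<^sub>R p = a' - b'" "norm a' \<le> \<rho>"
        using abs by blast
      have b'n: "norm b' \<le> \<rho> + r"
      proof -
        have "b' = a' - (r / norm p) *\<^sub>R p" unfolding ab'(3) by simp
        then have "norm b' \<le> norm a' + norm ((r / norm p) *\<^sub>R p)" using norm_triangle_ineq4 by metis
        then show ?thesis using ab'(4) r False by simp
      qed
      have o1: "u \<bullet> (a' - a) \<le> 0" using proj_obtuse[OF A ne(1) ab'(1), of x] by (simp add: u_def a_def)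
      have o2: "(e - u) \<bullet> (b' - b) \<le> 0"
      proof -
        have "(2 *\<^sub>R a - x - b) \<bullet> (b' - b) \<le> 0"
          using proj_obtuse[OF B ne(2) ab'(2), of "reflector A x"] unfolding b_def[symmetric] unfolding rf .
        moreover have "2 *\<^sub>R a - x - b = e - u" by (simp add: e_def u_def scaleR_2)
        ultimately show ?thesis by simp
      qed
      have "u \<bullet> p = p \<bullet> p" using p(2)[OF p(1)] by (simp add: inner_diff_left)
      then have "r * norm p = u \<bullet> ((r / norm p) *\<^sub>R p)"
        using False by (simp add: dot_square_norm power2_eq_square)
      \<comment> \<open>The regrouping isolates the two products with a sign from the variational
        inequalities; every remaining term contains the factor e.\<close>
      also have "\<dots> = u \<bullet> (a' - a) + u \<bullet> e + (e - u) \<bullet> (b' - b) - e \<bullet> (b' - b)"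
        unfolding ab'(3) by (simp add: e_def inner_diff_left inner_diff_right)
      also have "\<dots> \<le> u \<bullet> e - e \<bullet> (b' - b)" using o1 o2 by simp
      also have "\<dots> = e \<bullet> (u - (b' - b))" by (simp add: inner_diff_right inner_commute)
      also have "\<dots> \<le> norm e * norm (u - (b' - b))" by (rule norm_cauchy_schwarz)
      also have "\<dots> \<le> norm e * N"
      proof (rule mult_left_mono)
        show "norm (u - (b' - b)) \<le> N"
          using norm_triangle_ineq4[of u "b' - b"] norm_triangle_ineq4[of b' b] un b'n bn
          unfolding N_def by linarith
      qed simp
      finally show ?thesis using r by (simp add: field_simps)
    qed
    obtain c where c: "c \<in> A \<inter> B" "norm (c - a) \<le> (\<rho> + norm a) / r * norm (a - b)"
      using relatively_absorbing_point_near[OF A(2) B(2) sub r abs in_A in_B diff[OF in_A in_B]] by blast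
    have cn: "norm (c - a) \<le> N / r * norm e"
    proof (rule order_trans[OF c(2)], unfold e_def, rule mult_right_mono)
      show "(\<rho> + norm a) / r \<le> N / r"
        using an r R \<rho> by (intro divide_right_mono) (auto simp: N_def)
    qed simp
    have "c + (u - p) \<in> Fix (dr A B)" unfolding Fix_dr[OF A B S] using c(1) p(2) by blast
    then have "infdist x (Fix (dr A B)) \<le> dist x (c + (u - p))" by (rule infdist_le)
    also have "\<dots> = norm (p - (c - a))" by (simp add: dist_norm u_def algebra_simps)
    also have "\<dots> \<le> norm p + norm (c - a)" by (rule norm_triangle_ineq4)
    also have "\<dots> \<le> k * norm e" using pn cn by (simp add: k_def)
    finally show ?thesis unfolding e .
  qed
  moreover have "k \<ge> 0" using N r by (simp add: k_def)
  ultimately show ?thesis by blast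
qed

lemma relatively_absorbing_subspaces:
  fixes A :: "'a::{real_inner, complete_space} set"
  assumes A: "subspace A" "closed A" and B: "subspace B" "closed B"
    and cl: "closed {a + b | a b. a \<in> A \<and> b \<in> B}"
  shows "relatively_absorbing {a + b | a b. a \<in> A \<and> b \<in> B} A B"
proof -
  let ?S = "{a + b | a b. a \<in> A \<and> b \<in> B}"
  have S: "subspace ?S" by (rule subspace_sums[OF A(1) B(1)])
  obtain k where k: "k \<ge> 0" "\<And>a b. a \<in> A \<Longrightarrow> b \<in> B \<Longrightarrow>
      \<exists>a'\<in>A. \<exists>b'\<in>B. a + b = a' + b' \<and> norm a' \<le> k * norm (a + b)"
    using open_sum_closed[OF A B cl] unfolding open_sum_def by metis
  \<comment> \<open>The radius 1 is arbitrary by homogeneity, and the constant k of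
    \<open>open_sum\<close> then serves as the uniform bound.\<close>
  have "\<exists>a\<in>A. \<exists>b\<in>B. s = a - b \<and> norm a \<le> k" if s: "s \<in> ?S" "norm s \<le> 1" for s
  proof -
    obtain a b where ab: "a \<in> A" "b \<in> B" "s = a + b" "norm a \<le> k * norm s" using s(1) k(2) by blast
    have "norm a \<le> k" using ab(4) mult_left_mono[OF s(2) k(1)] by simp
    then show ?thesis using ab subspace_neg[OF B(1) ab(2)] by (intro bexI[of _ a] bexI[of _ "- b"]) auto
  qed
  moreover have "a - b \<in> ?S" if "a \<in> A" "b \<in> B" for a b
    using that subspace_neg[OF B(1) that(2)] by (intro CollectI exI[of _ a] exI[of _ "- b"]) auto
  ultimately show ?thesis
    unfolding relatively_absorbing_def
    using S orth_decomposable_closed_subspace[OF cl S] zero_less_one by blast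
qed

section \<open>Regularity in finite dimension\<close>

text \<open>Induction on the index set: v in the intersection so far and w in the new subspace are
  both near x, so v - w is small and splits as v' + w' with v' small; then v - v' = w + w' lies in
  both. Speaking of points within d avoids any question of attained distances.\<close>

lemma subspaces_linearly_regular:
  fixes W :: "'i \<Rightarrow> 'a::real_inner set"
  assumes fd: "fin_dim TYPE('a)" and "finite I" and "\<And>i. i \<in> I \<Longrightarrow> subspace (W i)"
  shows "\<exists>\<kappa>\<ge>0. \<forall>x d. d \<ge> 0 \<longrightarrow> (\<forall>i\<in>I. \<exists>w\<in>W i. norm (x - w) \<le> d) \<longrightarrow>
           (\<exists>w\<in>\<Inter>i\<in>I. W i. norm (x - w) \<le> \<kappa> * d)"
  using assms(2,3)
proof (induction I rule: finite_induct)
  case empty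
  have "\<exists>w\<in>UNIV. norm (x - w) \<le> 0 * d" for x :: 'a and d by (intro bexI[of _ x]) auto
  then show ?case by force
next
  case (insert j I)
  define V where "V = (\<Inter>i\<in>I. W i)"
  have V: "subspace V" unfolding V_def by (intro subspace_Inter) (use insert.prems in auto)
  have Wj: "subspace (W j)" using insert.prems by simp
  obtain \<kappa> where \<kappa>: "\<kappa> \<ge> 0" "\<And>x d. d \<ge> 0 \<Longrightarrow> (\<forall>i\<in>I. \<exists>w\<in>W i. norm (x - w) \<le> d) \<Longrightarrow>
           \<exists>w\<in>V. norm (x - w) \<le> \<kappa> * d"
    using insert.IH insert.prems unfolding V_def by (metis insert_iff)
  obtain k where k: "k \<ge> 0" "\<And>v w. v \<in> V \<Longrightarrow> w \<in> W j \<Longrightarrow>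
      \<exists>v'\<in>V. \<exists>w'\<in>W j. v + w = v' + w' \<and> norm v' \<le> k * norm (v + w)"
    using open_sum_fin_dim[OF fd V Wj] unfolding open_sum_def by metis
  have "\<exists>w\<in>V \<inter> W j. norm (x - w) \<le> (\<kappa> + k * (\<kappa> + 1)) * d"
    if d: "d \<ge> 0" and near: "\<forall>i\<in>insert j I. \<exists>w\<in>W i. norm (x - w) \<le> d" for x d
  proof -
    obtain w where w: "w \<in> W j" "norm (x - w) \<le> d" using near by auto
    obtain v where v: "v \<in> V" "norm (x - v) \<le> \<kappa> * d" using \<kappa>(2)[OF d] near by blast
    obtain v' w' where vw: "v' \<in> V" "w' \<in> W j" "v + - w = v' + w'" "norm v' \<le> k * norm (v + - w)"
      using k(2)[OF v(1) subspace_neg[OF Wj w(1)]] by blast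
    have "v - v' \<in> V" using V v(1) vw(1) by (rule subspace_diff)
    moreover have "v - v' = w + w'" using vw(3) by (simp add: algebra_simps)
    then have "v - v' \<in> W j" using Wj w(1) vw(2) by (simp add: subspace_add)
    moreover have "norm (x - (v - v')) \<le> (\<kappa> + k * (\<kappa> + 1)) * d"
    proof -
      have "norm (v + - w) \<le> (\<kappa> + 1) * d"
        using norm_triangle_ineq4[of "x - w" "x - v"] w(2) v(2) by (simp add: algebra_simps)
      then have "norm v' \<le> k * ((\<kappa> + 1) * d)" using vw(4) mult_left_mono[OF _ k(1)] order_trans by blast
      moreover have "norm (x - (v - v')) \<le> norm (x - v) + norm v'"
        using norm_triangle_ineq[of "x - v" v'] by (simp add: algebra_simps)
      ultimately show ?thesis using v(2) by (simp add: algebra_simps)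
    qed
    ultimately show ?thesis by blast
  qed
  moreover have "(\<Inter>i\<in>insert j I. W i) = V \<inter> W j" by (auto simp: V_def)
  moreover have "\<kappa> + k * (\<kappa> + 1) \<ge> 0" using \<kappa>(1) k(1) by simp
  ultimately show ?case by metis
qed

text \<open>Approximate all sets by a point of the common direction space, then shrink it towards the
  common relative interior point c; the shrinking factor is proportional to the distance.\<close>

lemma bdd_lin_regular_common_rel_interior:
  fixes E W :: "'i \<Rightarrow> 'a::real_inner set"
  assumes fd: "fin_dim TYPE('a)" and I: "finite I" "I \<noteq> {}"
    and W: "\<And>i. i \<in> I \<Longrightarrow> subspace (W i)" and E: "\<And>i. i \<in> I \<Longrightarrow> convex (E i)"
    and EW: "\<And>i e. i \<in> I \<Longrightarrow> e \<in> E i \<Longrightarrow> e - c \<in> W i"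
    and eps: "\<epsilon> > 0" and WE: "\<And>i w. i \<in> I \<Longrightarrow> w \<in> W i \<Longrightarrow> norm w \<le> \<epsilon> \<Longrightarrow> c + w \<in> E i"
  shows "bdd_lin_regular I E"
  unfolding bdd_lin_regular_def
proof (intro conjI allI impI)
  have cE: "c \<in> E i" if "i \<in> I" for i using WE[OF that subspace_0[OF W[OF that]]] eps by simp
  then show "(\<Inter>i\<in>I. E i) \<noteq> {}" by blast
  fix \<rho> :: real assume \<rho>: "\<rho> > 0"
  have "\<exists>\<kappa>\<ge>0. \<forall>x d. d \<ge> 0 \<longrightarrow> (\<forall>i\<in>I. \<exists>w\<in>W i. norm (x - w) \<le> d) \<longrightarrow>
           (\<exists>w\<in>\<Inter>i\<in>I. W i. norm (x - w) \<le> \<kappa> * d)"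
    by (rule subspaces_linearly_regular[OF fd I(1) W])
  then obtain \<kappa> where \<kappa>: "\<kappa> \<ge> 0" "\<And>x d. d \<ge> 0 \<Longrightarrow> (\<forall>i\<in>I. \<exists>w\<in>W i. norm (x - w) \<le> d) \<Longrightarrow>
           \<exists>w\<in>\<Inter>i\<in>I. W i. norm (x - w) \<le> \<kappa> * d"
    by blast
  \<comment> \<open>A bound for w: its distance to x - c is at most \<kappa> d, and d < D + 1 is at
    most \<rho> + \<open>norm c\<close> + 1.\<close>
  define N where "N = (1 + \<kappa>) * (\<rho> + norm c + 1)"
  define \<mu> where "\<mu> = \<kappa> + (1 + \<kappa>) / \<epsilon> * N + 1"
  have N: "N \<ge> 0" unfolding N_def using \<kappa>(1) \<rho> by simp
  have \<mu>: "\<mu> > 0" unfolding \<mu>_def using \<kappa>(1) eps N by (simp add: add_nonneg_pos)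
  have "infdist x (\<Inter>i\<in>I. E i) \<le> \<mu> * Max ((\<lambda>i. infdist x (E i)) ` I)" if x: "norm x \<le> \<rho>" for x
  proof -
    define D where "D = Max ((\<lambda>i. infdist x (E i)) ` I)"
    have le_D: "infdist x (E i) \<le> D" if "i \<in> I" for i unfolding D_def using I that by (intro Max_ge) auto
    have "D \<le> norm (x - c)"
      unfolding D_def using I cE infdist_le[of c _ x] by (subst Max_le_iff) (auto simp: dist_norm)
    then have D: "D \<le> \<rho> + norm c" using norm_triangle_ineq4[of x c] x by linarith
    have D0: "D \<ge> 0" using I le_D infdist_nonneg order_trans by blast
    have "infdist x (\<Inter>i\<in>I. E i) / \<mu> \<le> D"
    proof (rule dense_ge_bounded)
      show "D < D + 1" by simp
      \<comment> \<open>The distance D to the sets need not be attained, so points are chosen within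
        a slightly larger d. The upper limit D + 1 keeps all constants independent of d.\<close>
      fix d assume d: "D < d" "d < D + 1"
      have "\<exists>e\<in>E i. dist x e < d" if "i \<in> I" for i
      proof -
        have ne: "E i \<noteq> {}" using cE[OF that] by blast
        have "(INF e\<in>E i. dist x e) < d"
          using le_D[OF that] d(1) unfolding infdist_notempty[OF ne] by linarith
        then show ?thesis by (subst (asm) cINF_less_iff[OF ne]) auto
      qed
      then obtain e where e: "\<And>i. i \<in> I \<Longrightarrow> e i \<in> E i" "\<And>i. i \<in> I \<Longrightarrow> dist x (e i) < d" by metis
      have "\<exists>w\<in>W i. norm (x - c - w) \<le> d" if "i \<in> I" for i
        by (rule bexI[OF _ EW[OF that e(1)[OF that]]]) (use e(2)[OF that] in \<open>simp add: dist_norm\<close>)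
      then obtain w where w: "\<And>i. i \<in> I \<Longrightarrow> w \<in> W i" "norm (x - c - w) \<le> \<kappa> * d"
        using \<kappa>(2)[of d "x - c"] D0 d(1) by (force simp: INT_iff)
      define h where "h = (1 + \<kappa>) * d"
      have h: "h > 0" using \<kappa>(1) D0 d(1) by (simp add: h_def)
      \<comment> \<open>The weight for which l \<epsilon>/h = 1 - l. Mixing \<open>e i\<close> with
        the point of the \<epsilon>-ball around c in direction v then cancels \<open>e i\<close> and
        leaves the same point c + (1 - l) w for every i.\<close>
      define l where "l = h / (\<epsilon> + h)"
      have l: "0 < l" "l < 1" "l \<le> h / \<epsilon>" "1 - l = \<epsilon> / (\<epsilon> + h)"
        using eps h by (auto simp: l_def field_simps)
      have wN: "norm w \<le> N"
      proof -
        have "norm w \<le> norm (x - c) + norm (x - c - w)"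
          using norm_triangle_ineq4[of "x - c" "x - c - w"] by simp
        also have "\<dots> \<le> (\<rho> + norm c) + \<kappa> * d" using norm_triangle_ineq4[of x c] x w(2) by linarith
        also have "\<dots> \<le> (\<rho> + norm c + 1) + \<kappa> * (\<rho> + norm c + 1)"
          using D d(2) mult_left_mono[OF _ \<kappa>(1), of d "\<rho> + norm c + 1"] by simp
        finally show ?thesis by (simp add: N_def algebra_simps)
      qed
      have "c + (1 - l) *\<^sub>R w \<in> E i" if i: "i \<in> I" for i
      proof -
        define v where "v = w - (e i - c)"
        have vW: "v \<in> W i" unfolding v_def by (intro subspace_diff[OF W[OF i]] w(1)[OF i] EW[OF i e(1)[OF i]])
        have "norm v \<le> h"
          using norm_triangle_ineq4[of "x - e i" "x - c - w"] e(2)[OF i] w(2)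
          by (simp add: v_def h_def dist_norm algebra_simps)
        then have "(\<epsilon> / h) * norm v \<le> (\<epsilon> / h) * h" using eps h by (intro mult_left_mono) auto
        then have "c + (\<epsilon> / h) *\<^sub>R v \<in> E i"
          using eps h vW by (intro WE[OF i] subspace_scale[OF W[OF i]]) auto
        then have "(1 - l) *\<^sub>R e i + l *\<^sub>R (c + (\<epsilon> / h) *\<^sub>R v) \<in> E i"
          using l e(1)[OF i] by (intro convexD[OF E[OF i]]) auto
        moreover have "l * (\<epsilon> / h) = 1 - l" unfolding l(4) using h by (simp add: l_def)
        then have "(1 - l) *\<^sub>R e i + l *\<^sub>R (c + (\<epsilon> / h) *\<^sub>R v) = c + (1 - l) *\<^sub>R w"
          by (simp only: scaleR_add_right scaleR_scaleR) (simp add: v_def algebra_simps)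
        ultimately show ?thesis by simp
      qed
      then have "infdist x (\<Inter>i\<in>I. E i) \<le> dist x (c + (1 - l) *\<^sub>R w)" by (intro infdist_le) blast
      also have "\<dots> = norm ((x - c - w) + l *\<^sub>R w)" by (simp add: dist_norm algebra_simps)
      also have "\<dots> \<le> norm (x - c - w) + l * norm w"
        using norm_triangle_ineq[of "x - c - w" "l *\<^sub>R w"] l by simp
      also have "\<dots> \<le> \<kappa> * d + (h / \<epsilon>) * N"
        using w(2) mult_mono[OF l(3) wN] h eps by simp
      also have "\<dots> = (\<mu> - 1) * d" by (simp add: \<mu>_def h_def algebra_simps)
      also have "\<dots> \<le> \<mu> * d" using D0 d(1) by (simp add: algebra_simps)
      finally show "infdist x (\<Inter>i\<in>I. E i) / \<mu> \<le> d" using \<mu> by (simp add: field_simps)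
    qed
    then show ?thesis using \<mu> by (simp add: D_def field_simps)
  qed
  then show "\<exists>\<mu>>0. \<forall>x. norm x \<le> \<rho> \<longrightarrow> infdist x (\<Inter>i\<in>I. E i) \<le> \<mu> * Max ((\<lambda>i. infdist x (E i)) ` I)"
    using \<mu> by blast
qed

section \<open>Consequences of a common relative interior point\<close>

lemma rel_interior_span_cball:
  fixes A :: "'a::real_normed_vector set"
  assumes c: "c \<in> rel_interior A"
  shows "\<exists>\<epsilon>>0. \<forall>l\<in>span ((\<lambda>x. x - c) ` A). norm l \<le> \<epsilon> \<longrightarrow> c + l \<in> A"
proof -
  obtain e where e: "c \<in> A" "e > 0" "ball c e \<inter> affine hull A \<subseteq> A"
    using c unfolding mem_rel_interior_ball by blast
  have aff: "affine hull A = (+) c ` span ((\<lambda>x. x - c) ` A)"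
    using affine_hull_span_gen[OF hull_inc[OF e(1)]] by simp
  \<comment> \<open>Half the radius, since a closed ball is wanted and relative interiority provides
    an open one.\<close>
  have "c + l \<in> A" if "l \<in> span ((\<lambda>x. x - c) ` A)" "norm l \<le> e / 2" for l
    using that e(2) by (intro subsetD[OF e(3)]) (auto simp: aff dist_norm)
  then show ?thesis using e(2) by (intro exI[of _ "e / 2"]) auto
qed

lemma relatively_absorbing_rel_interior:
  fixes A :: "'a::real_inner set"
  assumes fd: "fin_dim TYPE('a)" and c: "c \<in> rel_interior A" "c \<in> rel_interior B"
  defines "S \<equiv> {l + m | l m. l \<in> span ((\<lambda>x. x - c) ` A) \<and> m \<in> span ((\<lambda>x. x - c) ` B)}"
  shows "relatively_absorbing S A B"
proof -
  define L M where "L = span ((\<lambda>x. x - c) ` A)" and "M = span ((\<lambda>x. x - c) ` B)"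
  have L: "subspace L" and M: "subspace M" unfolding L_def M_def by (rule subspace_span)+
  have S_eq: "S = {l + m | l m. l \<in> L \<and> m \<in> M}" unfolding S_def L_def M_def ..
  have S: "subspace S" unfolding S_eq by (rule subspace_sums[OF L M])
  obtain a where a: "a > 0" "\<And>l. l \<in> L \<Longrightarrow> norm l \<le> a \<Longrightarrow> c + l \<in> A"
    using rel_interior_span_cball[OF c(1)] unfolding L_def by metis
  obtain b where b: "b > 0" "\<And>l. l \<in> M \<Longrightarrow> norm l \<le> b \<Longrightarrow> c + l \<in> B"
    using rel_interior_span_cball[OF c(2)] unfolding M_def by metis
  obtain k where k: "k \<ge> 0" "\<And>l m. l \<in> L \<Longrightarrow> m \<in> M \<Longrightarrow>
      \<exists>l'\<in>L. \<exists>m'\<in>M. l + m = l' + m' \<and> norm l' \<le> k * norm (l + m)"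
    using open_sum_fin_dim[OF fd L M] unfolding open_sum_def by metis
  define \<epsilon> where "\<epsilon> = min a b"
  \<comment> \<open>A vector s = l + m with l bounded by k times its norm has m bounded by k + 1
    times its norm, so both parts stay below \<epsilon>; then s is the difference of c + l in A and
    c - m in B.\<close>
  define r where "r = \<epsilon> / (k + 1)"
  have \<epsilon>: "\<epsilon> > 0" "\<epsilon> \<le> a" "\<epsilon> \<le> b" using a(1) b(1) by (auto simp: \<epsilon>_def)
  have r: "r > 0" "(k + 1) * r = \<epsilon>" using \<epsilon>(1) k(1) by (auto simp: r_def)
  have "\<exists>x\<in>A. \<exists>y\<in>B. s = x - y \<and> norm x \<le> norm c + \<epsilon>" if s: "s \<in> S" "norm s \<le> r" for s
  proof -
    obtain l m where lm: "l \<in> L" "m \<in> M" "s = l + m" "norm l \<le> k * norm s"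
      using s(1) k(2) unfolding S_eq by blast
    have "norm m \<le> norm s + norm l" using norm_triangle_ineq4[of s l] lm(3) by simp
    moreover have "k * norm s \<le> k * r" by (rule mult_left_mono[OF s(2) k(1)])
    moreover have "k * r + r = \<epsilon>" using r(2) by (simp add: algebra_simps)
    ultimately have n: "norm l \<le> \<epsilon>" "norm m \<le> \<epsilon>" using lm(4) s(2) r(1) by linarith+
    have "c + l \<in> A" using n \<epsilon> by (intro a(2) lm) auto
    moreover have "c + - m \<in> B" using n \<epsilon> by (intro b(2) subspace_neg[OF M] lm) auto
    moreover have "norm (c + l) \<le> norm c + \<epsilon>" using norm_triangle_ineq[of c l] n by linarith
    ultimately show ?thesis unfolding lm(3) by (intro bexI[of _ "c + l"] bexI[of _ "c + - m"]) auto
  qed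
  moreover have "x - y \<in> S" if "x \<in> A" "y \<in> B" for x y
  proof -
    have "x - c \<in> L" "y - c \<in> M" unfolding L_def M_def using that by (auto intro: span_base)
    moreover from this have "- (y - c) \<in> M" using subspace_neg[OF M] by blast
    moreover have "x - y = (x - c) + - (y - c)" by simp
    ultimately show ?thesis unfolding S_eq by blast
  qed
  ultimately show ?thesis
    unfolding relatively_absorbing_def using S orth_decomposable_fin_dim[OF fd S] r(1) by blast
qed

text \<open>The fixed point set for i is (A \<inter> B_i) + N_i, with direction space W_i = (L
  \<inter> M_i) + N_i. The point c lies in all these sets with a ball of W_i around it, which is
  what the general regularity criterion asks for.\<close>

lemma Fix_dr_bdd_lin_regular:
  fixes A :: "'a::{real_inner, complete_space} set" and B :: "'i \<Rightarrow> 'a set"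
  assumes fd: "fin_dim TYPE('a)" and I: "finite I" "I \<noteq> {}"
    and A: "closed A" "convex A" and B: "\<And>i. i \<in> I \<Longrightarrow> closed (B i) \<and> convex (B i)"
    and c: "c \<in> rel_interior A" "\<And>i. i \<in> I \<Longrightarrow> c \<in> rel_interior (B i)"
  shows "bdd_lin_regular I (\<lambda>i. Fix (dr A (B i)))"
proof -
  define L where "L = span ((\<lambda>x. x - c) ` A)"
  define M where "M i = span ((\<lambda>x. x - c) ` B i)" for i
  define S where "S i = {l + m | l m. l \<in> L \<and> m \<in> M i}" for i
  define N where "N i = {u. \<forall>s\<in>S i. u \<bullet> s = 0}" for i
  define W where "W i = {l + u | l u. l \<in> L \<inter> M i \<and> u \<in> N i}" for i
  have L: "subspace L" and M: "subspace (M i)" for i unfolding L_def M_def by (rule subspace_span)+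
  have N: "subspace (N i)" for i
    by (auto simp: N_def subspace_def inner_simps)
  have W: "subspace (W i)" for i
    unfolding W_def by (intro subspace_sums subspace_inter L M N)
  have ra: "relatively_absorbing (S i) A (B i)" if "i \<in> I" for i
    unfolding S_def L_def M_def by (rule relatively_absorbing_rel_interior[OF fd c(1) c(2)[OF that]])
  have FixE: "Fix (dr A (B i)) = {x + u | x u. x \<in> A \<inter> B i \<and> u \<in> N i}" if "i \<in> I" for i
    using Fix_dr[OF A _ _ ra[OF that]] B[OF that] unfolding N_def by simp
  obtain a where a: "a > 0" "\<And>l. l \<in> L \<Longrightarrow> norm l \<le> a \<Longrightarrow> c + l \<in> A"
    using rel_interior_span_cball[OF c(1)] unfolding L_def by metis
  have "\<exists>b>0. \<forall>l\<in>M i. norm l \<le> b \<longrightarrow> c + l \<in> B i" if "i \<in> I" for i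
    using rel_interior_span_cball[OF c(2)[OF that]] unfolding M_def .
  then obtain b where b: "\<And>i. i \<in> I \<Longrightarrow> b i > 0"
    "\<And>i l. i \<in> I \<Longrightarrow> l \<in> M i \<Longrightarrow> norm l \<le> b i \<Longrightarrow> c + l \<in> B i" by metis
  define \<epsilon> where "\<epsilon> = min a (Min (b ` I))"
  have \<epsilon>: "\<epsilon> > 0" "\<epsilon> \<le> a" "\<And>i. i \<in> I \<Longrightarrow> \<epsilon> \<le> b i"
    using a(1) b(1) I by (auto simp: \<epsilon>_def min.coboundedI2)
  show ?thesis
  proof (rule bdd_lin_regular_common_rel_interior[OF fd I, where W = W and c = c and \<epsilon> = \<epsilon>])
    fix i assume i: "i \<in> I"
    show "subspace (W i)" by (rule W)
    have "Fix (dr A (B i)) = (\<Union>x\<in>A \<inter> B i. \<Union>u\<in>N i. {x + u})" unfolding FixE[OF i] by blast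
    also have "convex \<dots>"
      using A B[OF i] by (intro convex_sums convex_Int subspace_imp_convex[OF N]) auto
    finally show "convex (Fix (dr A (B i)))" .
    show "e - c \<in> W i" if e0: "e \<in> Fix (dr A (B i))" for e
    proof -
      obtain x u where e: "e = x + u" "x \<in> A" "x \<in> B i" "u \<in> N i" using e0 unfolding FixE[OF i] by blast
      have "x - c \<in> L \<inter> M i" unfolding L_def M_def using e by (auto intro: span_base)
      moreover have "e - c = (x - c) + u" by (simp add: e)
      ultimately show ?thesis unfolding W_def using e(4) by blast
    qed
    show "c + w \<in> Fix (dr A (B i))" if w: "w \<in> W i" "norm w \<le> \<epsilon>" for w
    proof -
      obtain l u where lu: "w = l + u" "l \<in> L" "l \<in> M i" "u \<in> N i" using w(1) unfolding W_def by blast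
      \<comment> \<open>The two parts of w are orthogonal because L lies in S_i, so
        \<open>norm l\<close> is at most \<open>norm w\<close>. The radius \<epsilon> therefore
        survives the passage from A and B_i to the fixed point set.\<close>
      have "l + 0 \<in> S i" unfolding S_def using lu(2) subspace_0[OF M] by blast
      then have "u \<bullet> l = 0" using lu(4) unfolding N_def by simp
      then have "(norm w)\<^sup>2 = (norm l)\<^sup>2 + (norm u)\<^sup>2"
        unfolding lu(1) power2_norm_eq_inner by (simp add: inner_add_left inner_add_right inner_commute)
      then have "(norm l)\<^sup>2 \<le> (norm w)\<^sup>2" by simp
      then have "norm l \<le> norm w" by (rule power2_le_imp_le) simp
      then have "c + l \<in> A \<inter> B i" using \<epsilon>(2) \<epsilon>(3)[OF i] w(2)
        a(2)[OF lu(2)] b(2)[OF i lu(3)] by simp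
      moreover have "c + w = (c + l) + u" by (simp add: lu(1))
      ultimately show ?thesis unfolding FixE[OF i] using lu(4) by blast
    qed
  qed (rule \<epsilon>)
qed

theorem theorem8p4:
  fixes A :: "'a::{real_inner, complete_space} set"
    and B :: "nat \<Rightarrow> 'a set"
    and m :: nat
    and x :: "nat \<Rightarrow> 'a"
  assumes m: "m \<ge> 1"
    and A: "closed A" "convex A"
    and B: "\<And>i. i \<in> {1..m} \<Longrightarrow> closed (B i) \<and> convex (B i)"
    and C: "A \<inter> (\<Inter>i\<in>{1..m}. B i) \<noteq> {}"
    and iter: "\<And>n. x (Suc n) =
        comp_upto (\<lambda>i y. proj (B i) (reflector A y) + y - proj A y) m (x n)"
    and cases:
      "((\<exists>S. finite S \<and> span S = (UNIV :: 'a set)) \<and>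
          rel_interior A \<inter> (\<Inter>i\<in>{1..m}. rel_interior (B i)) \<noteq> {})
       \<or> (subspace A \<and> (\<forall>i\<in>{1..m}. subspace (B i) \<and>
              closed {a + b | a b. a \<in> A \<and> b \<in> B i}) \<and>
          bdd_lin_regular {1..m}
            (\<lambda>i. Fix (\<lambda>y. proj (B i) (reflector A y) + y - proj A y)))"
  shows "\<exists>xb. xb \<in> (\<Inter>i\<in>{1..m}. Fix (\<lambda>y. proj (B i) (reflector A y) + y - proj A y))
           \<and> lin_conv x xb \<and> proj A xb \<in> A \<inter> (\<Inter>i\<in>{1..m}. B i)"
proof -
  have ne: "A \<noteq> {}" "i \<in> {1..m} \<Longrightarrow> B i \<noteq> {}" for i using C by auto
  have I: "finite {1..m}" "{1..m} \<noteq> {}" using m by auto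
  \<comment> \<open>The alternatives differ only in how they produce regularity and the absorbing
    subspaces; the convergence argument afterwards is common to both.\<close>
  from cases have key: "bdd_lin_regular {1..m} (\<lambda>i. Fix (dr A (B i))) \<and>
      (\<forall>i\<in>{1..m}. \<exists>S. relatively_absorbing S A (B i))"
  proof (elim disjE conjE)
    assume "\<exists>S. finite S \<and> span S = (UNIV :: 'a set)"
    then have fd: "fin_dim TYPE('a)" unfolding fin_dim_def .
    assume "rel_interior A \<inter> (\<Inter>i\<in>{1..m}. rel_interior (B i)) \<noteq> {}"
    then obtain c where c: "c \<in> rel_interior A" "\<And>i. i \<in> {1..m} \<Longrightarrow> c \<in> rel_interior (B i)" by blast
    have "bdd_lin_regular {1..m} (\<lambda>i. Fix (dr A (B i)))"
      by (rule Fix_dr_bdd_lin_regular[OF fd I A B c])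
    then show ?thesis using relatively_absorbing_rel_interior[OF fd c(1) c(2)] by blast
  next
    assume "subspace A" "\<forall>i\<in>{1..m}. subspace (B i) \<and> closed {a + b | a b. a \<in> A \<and> b \<in> B i}"
      "bdd_lin_regular {1..m} (\<lambda>i. Fix (dr A (B i)))"
    then show ?thesis using relatively_absorbing_subspaces[OF _ A(1)] B by blast
  qed
  have "\<exists>xb. xb \<in> (\<Inter>i\<in>{1..m}. Fix (dr A (B i))) \<and> lin_conv x xb"
  proof (rule cyclic_composition_lin_conv[OF m])
    fix i assume i: "i \<in> {1..m}"
    then obtain S where S: "relatively_absorbing S A (B i)" using key by blast
    show "(norm (dr A (B i) y - z))\<^sup>2 + (norm (y - dr A (B i) y))\<^sup>2 \<le> (norm (y - z))\<^sup>2"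
      if "z \<in> Fix (dr A (B i))" for y z
      using B[OF i] by (intro dr_quasi_firmly_nonexpansive[OF A ne(1) _ _ ne(2)[OF i] that]) auto
    show "\<exists>k\<ge>0. \<forall>y. norm y \<le> \<rho> \<longrightarrow> infdist y (Fix (dr A (B i))) \<le> k * norm (y - dr A (B i) y)" for \<rho>
      using B[OF i] by (intro dr_error_bound[OF A _ _ S]) auto
  qed (use key iter in auto)
  then obtain xb where xb: "xb \<in> (\<Inter>i\<in>{1..m}. Fix (dr A (B i)))" "lin_conv x xb" by blast
  \<comment> \<open>The fixed point equation says that \<open>proj A xb\<close> equals the
    projection of the reflected point onto \<open>B i\<close>, for each i.\<close>
  have "proj A xb \<in> B i" if i: "i \<in> {1..m}" for i
  proof -
    have "proj (B i) (reflector A xb) = proj A xb" using xb(1) i by (auto simp: Fix_def)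
    then show ?thesis using proj_in[of "B i" "reflector A xb"] B[OF i] ne(2)[OF i] by simp
  qed
  then show ?thesis using xb proj_in[OF A ne(1)] by blast
qed

end
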